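(* Let $\mathcal M$ be a GW*-algebra on a dense subspace $\mathcal D$ of a Hilbert space $\mathcal H$ such that the strong*-closure of $\overline{\mathcal M_b}$ equals $(\mathcal M'_{\rm w})'$, and let $E$ be a projection with $E\restriction_{\mathcal D}\in\mathcal M$. Then the closure of $\mathcal M_E=\{EX\restriction_{E\mathcal D}:X\in\mathcal M\}$ is a GW*-algebra on $\widetilde{\mathcal D}(\mathcal M_E)$.
   Context: $\mathcal L^\dagger(\mathcal D,\mathcal H)$: linear operators $X$ with $D(X)=\mathcal D$, $D(X^* )\supseteq\mathcal D$, involution $X^\dagger=X^*\restriction_{\mathcal D}$; $\mathcal L^\dagger(\mathcal D)$: those $X$ with $X\mathcal D\subset\mathcal D$, $X^\dagger\mathcal D\subset\mathcal D$; it is a *-algebra. An O*-algebra on $\mathcal D$ is a *-subalgebra of $\mathcal L^\dagger(\mathcal D)$. Graph topology $t_{\mathcal M}$ on $\mathcal D$: given by seminorms $\|\cdot\|$ and $\xi\mapsto\|X\xi\|$, $X\in\mathcal M$; $\widetilde{\mathcal D}(\mathcal M)$ denotes the completion of $\mathcal D[t_{\mathcal M}]$ (realized in $\mathcal H$), the closure of $\mathcal M$ is $\widetilde{\mathcal M}=\{\overline X\restriction_{\widetilde{\mathcal D}(\mathcal M)}\}$, and $\mathcal M$ is closed if $\mathcal D[t_{\mathcal M}]$ is complete. Weak commutant $\mathcal M'_{\rm w}=\{C\in\mathcal B(\mathcal H):\langle CX\xi,\eta\rangle=\langle C\xi,X^\dagger\eta\rangle\ \forall X\in\mathcal M,\ \xi,\eta\in\mathcal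 D\}$; $\mathcal M''_{{\rm w}c}=\{X\in\mathcal L^\dagger(\mathcal D):\langle CX\xi,\eta\rangle=\langle C\xi,X^\dagger\eta\rangle\ \forall C\in\mathcal M'_{\rm w},\xi,\eta\in\mathcal D\}$. A closed O*-algebra $\mathcal M$ on $\mathcal D$ is a GW*-algebra if $\mathcal M'_{\rm w}\mathcal D\subset\mathcal D$ and $\mathcal M=\mathcal M''_{{\rm w}c}$. $\mathcal M_b$ is the set of bounded elements of $\mathcal M$, $\overline{\mathcal M_b}=\{\overline X:X\in\mathcal M_b\}$; the strong*-topology on $\mathcal B(\mathcal H)$ is given by seminorms $A\mapsto\|A\xi\|+\|A^*\xi\|$. *)

theory Defs
  imports "HOL-Analysis.Analysis"
begin

text \<open>HOL-Analysis has only real inner product spaces, so we introduce complex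
Hilbert spaces as a type class: a complete normed space with a complex scalar
multiplication (compatible with the real one) and a complex inner product
(linear in the first argument, conjugate-linear in the second) inducing the norm.\<close>

class chilbert = real_normed_vector + complete_space +
  fixes scaleC :: "complex \<Rightarrow> 'a \<Rightarrow> 'a"
    and cinner :: "'a \<Rightarrow> 'a \<Rightarrow> complex"
  assumes scaleC_of_real: "scaleC (complex_of_real r) x = scaleR r x"
    and scaleC_add_right: "scaleC a (x + y) = scaleC a x + scaleC a y"
    and scaleC_add_left: "scaleC (a + b) x = scaleC a x + scaleC b x"
    and scaleC_scaleC: "scaleC a (scaleC b x) = scaleC (a * b) x"
    and scaleC_one: "scaleC 1 x = x"
    and cinner_commute: "cinner x y = cnj (cinner y x)"
    and cinner_add_left: "cinner (x + y) z = cinner x z + cinner y z"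
    and cinner_scaleC_left: "cinner (scaleC c x) y = c * cinner x y"
    and cinner_self_real: "Im (cinner x x) = 0 \<and> Re (cinner x x) \<ge> 0"
    and cinner_self_eq_0: "cinner x x = 0 \<longleftrightarrow> x = 0"
    and norm_cinner: "norm x = sqrt (Re (cinner x x))"

definition csubspace :: "'a::chilbert set \<Rightarrow> bool" where
  "csubspace S \<longleftrightarrow> 0 \<in> S \<and> (\<forall>x\<in>S. \<forall>y\<in>S. x + y \<in> S) \<and> (\<forall>c. \<forall>x\<in>S. scaleC c x \<in> S)"

text \<open>A Hilbert space inside the ambient type: a closed subspace.\<close>
definition hilbert_sub :: "'a::chilbert set \<Rightarrow> bool" where
  "hilbert_sub K \<longleftrightarrow> csubspace K \<and> closed K"

definition dense_in :: "'a::chilbert set \<Rightarrow> 'a set \<Rightarrow> bool" where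
  "dense_in D K \<longleftrightarrow> D \<subseteq> K \<and> K \<subseteq> closure D"

definition clinear_on :: "'a::chilbert set \<Rightarrow> ('a \<Rightarrow> 'a) \<Rightarrow> bool" where
  "clinear_on D f \<longleftrightarrow> (\<forall>x\<in>D. \<forall>y\<in>D. f (x + y) = f x + f y) \<and>
     (\<forall>c. \<forall>x\<in>D. f (scaleC c x) = scaleC c (f x))"

text \<open>Operators with domain \<open>D\<close> are represented by functions vanishing outside \<open>D\<close>.\<close>
definition ext_on :: "'a::chilbert set \<Rightarrow> ('a \<Rightarrow> 'a) \<Rightarrow> bool" where
  "ext_on D f \<longleftrightarrow> (\<forall>x. x \<notin> D \<longrightarrow> f x = 0)"

definition restr :: "'a::chilbert set \<Rightarrow> ('a \<Rightarrow> 'a) \<Rightarrow> 'a \<Rightarrow> 'a" where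
  "restr D f = (\<lambda>x. if x \<in> D then f x else 0)"

definition Ldag :: "'a::chilbert set \<Rightarrow> ('a \<Rightarrow> 'a) set" where
  "Ldag D = {X. ext_on D X \<and> clinear_on D X \<and> X ` D \<subseteq> D \<and>
      (\<forall>\<eta>\<in>D. \<exists>\<zeta>\<in>D. \<forall>\<xi>\<in>D. cinner (X \<xi>) \<eta> = cinner \<xi> \<zeta>)}"

definition dagger :: "'a::chilbert set \<Rightarrow> ('a \<Rightarrow> 'a) \<Rightarrow> 'a \<Rightarrow> 'a" where
  "dagger D X = (\<lambda>\<eta>. if \<eta> \<in> D then (THE \<zeta>. \<zeta> \<in> D \<and> (\<forall>\<xi>\<in>D. cinner (X \<xi>) \<eta> = cinner \<xi> \<zeta>)) else 0)"

definition Ostar :: "'a::chilbert set \<Rightarrow> 'a set \<Rightarrow> ('a \<Rightarrow> 'a) set \<Rightarrow> bool" where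
  "Ostar K D M \<longleftrightarrow> hilbert_sub K \<and> csubspace D \<and> dense_in D K \<and> M \<subseteq> Ldag D \<and> M \<noteq> {} \<and>
     (\<forall>X\<in>M. \<forall>Y\<in>M. (\<lambda>x. X x + Y x) \<in> M) \<and>
     (\<forall>c. \<forall>X\<in>M. (\<lambda>x. scaleC c (X x)) \<in> M) \<and>
     (\<forall>X\<in>M. \<forall>Y\<in>M. (\<lambda>x. X (Y x)) \<in> M) \<and>
     (\<forall>X\<in>M. dagger D X \<in> M)"

text \<open>Cauchy filters (= Cauchy nets) in \<open>D[t_M]\<close>.\<close>
definition tM_cauchy :: "('a::chilbert \<Rightarrow> 'a) set \<Rightarrow> 'a set \<Rightarrow> 'a filter \<Rightarrow> bool" where
  "tM_cauchy M D F \<longleftrightarrow> F \<noteq> bot \<and> eventually (\<lambda>x. x \<in> D) F \<and>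
     (\<forall>e>0. eventually (\<lambda>(x, y). norm (x - y) < e) (F \<times>\<^sub>F F)) \<and>
     (\<forall>X\<in>M. \<forall>e>0. eventually (\<lambda>(x, y). norm (X x - X y) < e) (F \<times>\<^sub>F F))"

definition closed_O :: "('a::chilbert \<Rightarrow> 'a) set \<Rightarrow> 'a set \<Rightarrow> bool" where
  "closed_O M D \<longleftrightarrow> (\<forall>F. tM_cauchy M D F \<longrightarrow>
      (\<exists>\<xi>\<in>D. ((\<lambda>x. x) \<longlongrightarrow> \<xi>) F \<and> (\<forall>X\<in>M. (X \<longlongrightarrow> X \<xi>) F)))"

text \<open>The completion of \<open>D[t_M]\<close> realized in the ambient Hilbert space.\<close>
definition Dtilde :: "('a::chilbert \<Rightarrow> 'a) set \<Rightarrow> 'a set \<Rightarrow> 'a set" where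
  "Dtilde M D = {\<xi>. \<exists>F. tM_cauchy M D F \<and> ((\<lambda>x. x) \<longlongrightarrow> \<xi>) F}"

text \<open>The closure of \<open>X\<close> restricted to \<open>Dtilde M D\<close>.\<close>
definition closure_op :: "('a::chilbert \<Rightarrow> 'a) set \<Rightarrow> 'a set \<Rightarrow> ('a \<Rightarrow> 'a) \<Rightarrow> 'a \<Rightarrow> 'a" where
  "closure_op M D X = (\<lambda>\<xi>. if \<xi> \<in> Dtilde M D then
      (THE \<zeta>. \<exists>F. tM_cauchy M D F \<and> ((\<lambda>x. x) \<longlongrightarrow> \<xi>) F \<and> (X \<longlongrightarrow> \<zeta>) F) else 0)"

definition closure_alg :: "('a::chilbert \<Rightarrow> 'a) set \<Rightarrow> 'a set \<Rightarrow> ('a \<Rightarrow> 'a) set" where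
  "closure_alg M D = closure_op M D ` M"

definition bop :: "'a::chilbert set \<Rightarrow> ('a \<Rightarrow> 'a) \<Rightarrow> bool" where
  "bop K A \<longleftrightarrow> ext_on K A \<and> clinear_on K A \<and> A ` K \<subseteq> K \<and>
     (\<exists>c. \<forall>x\<in>K. norm (A x) \<le> c * norm x)"

definition badj :: "'a::chilbert set \<Rightarrow> ('a \<Rightarrow> 'a) \<Rightarrow> 'a \<Rightarrow> 'a" where
  "badj K A = (\<lambda>\<eta>. if \<eta> \<in> K then (THE \<zeta>. \<zeta> \<in> K \<and> (\<forall>\<xi>\<in>K. cinner (A \<xi>) \<eta> = cinner \<xi> \<zeta>)) else 0)"

definition is_projection :: "'a::chilbert set \<Rightarrow> ('a \<Rightarrow> 'a) \<Rightarrow> bool" where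
  "is_projection K E \<longleftrightarrow> bop K E \<and> (\<forall>x. E (E x) = E x) \<and> badj K E = E"

definition bcomm :: "'a::chilbert set \<Rightarrow> ('a \<Rightarrow> 'a) set \<Rightarrow> ('a \<Rightarrow> 'a) set" where
  "bcomm K S = {A. bop K A \<and> (\<forall>C\<in>S. \<forall>x\<in>K. A (C x) = C (A x))}"

definition sstar_closure :: "'a::chilbert set \<Rightarrow> ('a \<Rightarrow> 'a) set \<Rightarrow> ('a \<Rightarrow> 'a) set" where
  "sstar_closure K S = {A. bop K A \<and> (\<forall>V e. finite V \<and> V \<subseteq> K \<and> e > 0 \<longrightarrow>
      (\<exists>B\<in>S. \<forall>\<xi>\<in>V. norm (A \<xi> - B \<xi>) + norm (badj K (\<lambda>x. A x - B x) \<xi>) < e))}"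

definition wcomm :: "'a::chilbert set \<Rightarrow> 'a set \<Rightarrow> ('a \<Rightarrow> 'a) set \<Rightarrow> ('a \<Rightarrow> 'a) set" where
  "wcomm K D M = {C. bop K C \<and> (\<forall>X\<in>M. \<forall>\<xi>\<in>D. \<forall>\<eta>\<in>D.
      cinner (C (X \<xi>)) \<eta> = cinner (C \<xi>) (dagger D X \<eta>))}"

definition wbicomm_c :: "'a::chilbert set \<Rightarrow> 'a set \<Rightarrow> ('a \<Rightarrow> 'a) set \<Rightarrow> ('a \<Rightarrow> 'a) set" where
  "wbicomm_c K D M = {X \<in> Ldag D. \<forall>C\<in>wcomm K D M. \<forall>\<xi>\<in>D. \<forall>\<eta>\<in>D.
      cinner (C (X \<xi>)) \<eta> = cinner (C \<xi>) (dagger D X \<eta>)}"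

definition GWstar :: "'a::chilbert set \<Rightarrow> 'a set \<Rightarrow> ('a \<Rightarrow> 'a) set \<Rightarrow> bool" where
  "GWstar K D M \<longleftrightarrow> Ostar K D M \<and> closed_O M D \<and>
     (\<forall>C\<in>wcomm K D M. C ` D \<subseteq> D) \<and> M = wbicomm_c K D M"

definition Mb :: "'a::chilbert set \<Rightarrow> ('a \<Rightarrow> 'a) set \<Rightarrow> ('a \<Rightarrow> 'a) set" where
  "Mb D M = {X \<in> M. \<exists>c. \<forall>\<xi>\<in>D. norm (X \<xi>) \<le> c * norm \<xi>}"

definition bclos :: "'a::chilbert set \<Rightarrow> 'a set \<Rightarrow> ('a \<Rightarrow> 'a) \<Rightarrow> 'a \<Rightarrow> 'a" where
  "bclos K D X = (THE A. bop K A \<and> (\<forall>\<xi>\<in>D. A \<xi> = X \<xi>))"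

definition ME :: "'a::chilbert set \<Rightarrow> ('a \<Rightarrow> 'a) \<Rightarrow> ('a \<Rightarrow> 'a) set \<Rightarrow> ('a \<Rightarrow> 'a) set" where
  "ME D E M = (\<lambda>X. restr (E ` D) (\<lambda>x. E (X x))) ` M"

end

theory Submission
  imports Defs
begin

text \<open>
  On \<open>E D\<close> the graph topologies of \<open>M\<close> and of \<open>M\<^sub>E\<close> coincide, since
  \<open>\<parallel>X \<xi>\<parallel>\<^sup>2 = \<langle>E X\<^sup>\<dagger> X \<xi>, \<xi>\<rangle>\<close>, and \<open>E\<close> is continuous, so \<open>M\<^sub>E\<close> is already closed on \<open>E D\<close>.
  An element \<open>X\<close> of the weak bicommutant of \<open>M\<^sub>E\<close> gives \<open>X E\<close> in the weak bicommutant of \<open>M\<close>,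
  which is \<open>M\<close>. For the invariance of \<open>E D\<close> under an operator \<open>C\<close> in the weak commutant of \<open>M\<^sub>E\<close>, put
  \<open>N = (M'\<^sub>w)'\<close>. By the density hypothesis \<open>C\<close> commutes with \<open>E N E\<close>, so
  \<open>\<Sum> A\<^sub>i E \<xi>\<^sub>i \<mapsto> \<Sum> A\<^sub>i C \<xi>\<^sub>i\<close> with \<open>A\<^sub>i \<in> N\<close> is bounded and extends \<open>C\<close> to an operator in \<open>N'\<close>.
  Projections onto closed graphs show that \<open>N' = M'\<^sub>w\<close>, and \<open>M'\<^sub>w\<close> maps \<open>D\<close> into \<open>D\<close>.
\<close>

section \<open>Complex Hilbert spaces\<close>

global_interpretation complex_vector: vector_space "scaleC :: complex \<Rightarrow> 'a \<Rightarrow> 'a::chilbert"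
  by unfold_locales (simp_all add: scaleC_add_right scaleC_add_left scaleC_scaleC scaleC_one)

lemma csubspace_eq_subspace: "csubspace = complex_vector.subspace"
  by (simp add: fun_eq_iff csubspace_def complex_vector.subspace_def)

lemmas csubspace_0 = complex_vector.subspace_0[folded csubspace_eq_subspace]
  and csubspace_add = complex_vector.subspace_add[folded csubspace_eq_subspace]
  and csubspace_diff = complex_vector.subspace_diff[folded csubspace_eq_subspace]
  and csubspace_scaleC = complex_vector.subspace_scale[folded csubspace_eq_subspace]

lemma csubspace_imp_subspace: "csubspace S \<Longrightarrow> subspace S"
  by (metis csubspace_0 csubspace_add csubspace_scaleC scaleC_of_real subspace_def)

lemma clinear_on_add: "clinear_on D f \<Longrightarrow> x \<in> D \<Longrightarrow> y \<in> D \<Longrightarrow> f (x + y) = f x + f y"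
  and clinear_on_scaleC: "clinear_on D f \<Longrightarrow> x \<in> D \<Longrightarrow> f (scaleC c x) = scaleC c (f x)"
  by (simp_all add: clinear_on_def)

lemma clinear_on_diff:
  assumes "csubspace D" "clinear_on D f" "x \<in> D" "y \<in> D"
  shows "f (x - y) = f x - f y"
  using clinear_on_add[OF assms(2) csubspace_diff[OF assms(1,3,4)] assms(4)] by simp

lemma clinear_on_0: "csubspace D \<Longrightarrow> clinear_on D f \<Longrightarrow> f 0 = 0"
  using clinear_on_diff[of D f 0 0] csubspace_0[of D] by simp

lemma cinner_scaleC_right: "cinner (x::'a::chilbert) (scaleC c y) = cnj c * cinner x y"
  by (metis cinner_commute cinner_scaleC_left complex_cnj_mult)

lemma cinner_add_right: "cinner (x::'a::chilbert) (y + z) = cinner x y + cinner x z"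
  by (metis cinner_commute cinner_add_left complex_cnj_add)

lemma cinner_self: "cinner (x::'a::chilbert) x = complex_of_real ((norm x)\<^sup>2)"
  using cinner_self_real[of x] by (simp add: norm_cinner complex_eq_iff)

lemma norm_sq_eq_Re_cinner: "(norm (x::'a::chilbert))\<^sup>2 = Re (cinner x x)"
  by (simp add: cinner_self)

lemma norm_sq_eq_cmod_cinner: "(norm (x::'a::chilbert))\<^sup>2 = cmod (cinner x x)"
  by (simp add: cinner_self norm_power)

lemma norm_scaleC: "norm (scaleC c (x::'a::chilbert)) = cmod c * norm x"
proof -
  have "(norm (scaleC c x))\<^sup>2 = cmod (c * cnj c * cinner x x)"
    unfolding norm_sq_eq_cmod_cinner by (simp add: cinner_scaleC_left cinner_scaleC_right mult_ac)
  also have "\<dots> = (cmod c * norm x)\<^sup>2"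
    by (simp only: norm_mult norm_sq_eq_cmod_cinner[symmetric] complex_mod_cnj power2_eq_square mult_ac)
  finally show ?thesis by (simp add: power2_eq_iff_nonneg)
qed

lemma norm_add_sq:
  "(norm ((x::'a::chilbert) + y))\<^sup>2 = (norm x)\<^sup>2 + 2 * Re (cinner x y) + (norm y)\<^sup>2"
proof -
  have "Re (cinner y x) = Re (cinner x y)" by (subst cinner_commute) simp
  then show ?thesis by (simp add: norm_sq_eq_Re_cinner cinner_add_left cinner_add_right)
qed

lemma norm_sq_diff_component:
  fixes x y :: "'a::chilbert"
  assumes "y \<noteq> 0"
  shows "(norm (x - scaleC (cinner x y / (norm y)\<^sup>2) y))\<^sup>2 =
    (norm x)\<^sup>2 - (cmod (cinner x y))\<^sup>2 / (norm y)\<^sup>2"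
proof -
  define a where "a = - (cinner x y / (norm y)\<^sup>2)"
  have "cnj a * cinner x y = - of_real ((cmod (cinner x y))\<^sup>2 / (norm y)\<^sup>2)"
    using complex_norm_square[of "cinner x y"] by (simp add: a_def mult.commute)
  then have cross: "Re (cinner x (scaleC a y)) = - ((cmod (cinner x y))\<^sup>2 / (norm y)\<^sup>2)"
    by (simp only: cinner_scaleC_right) simp
  have "norm (scaleC a y) = cmod (cinner x y) / norm y"
    using assms by (simp add: a_def norm_scaleC norm_divide norm_mult power2_eq_square)
  then have "(norm (x + scaleC a y))\<^sup>2 = (norm x)\<^sup>2 - (cmod (cinner x y))\<^sup>2 / (norm y)\<^sup>2"
    unfolding norm_add_sq cross by (simp add: power_divide)
  then show ?thesis by (simp add: a_def)
qed

lemma cinner_Cauchy_Schwarz: "cmod (cinner (x::'a::chilbert) y) \<le> norm x * norm y"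
proof (cases "y = 0")
  case True
  then show ?thesis using cinner_scaleC_right[of x 0 y] by simp
next
  case False
  then have "(cmod (cinner x y))\<^sup>2 / (norm y)\<^sup>2 \<le> (norm x)\<^sup>2"
    using norm_sq_diff_component[OF False, of x] by (metis diff_ge_0_iff_ge zero_le_power2)
  then have "(cmod (cinner x y))\<^sup>2 \<le> (norm x * norm y)\<^sup>2"
    using False by (simp add: field_simps power_mult_distrib)
  then show ?thesis by (rule power2_le_imp_le) simp
qed

global_interpretation cinner: bounded_bilinear "cinner :: 'a::chilbert \<Rightarrow> 'a \<Rightarrow> complex"
proof
  show "\<exists>K. \<forall>a b::'a. norm (cinner a b) \<le> norm a * norm b * K"
    by (rule exI[of _ 1]) (simp add: cinner_Cauchy_Schwarz)
qed (simp_all add: cinner_add_left cinner_add_right cinner_scaleC_left cinner_scaleC_right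
      scaleC_of_real[symmetric] scaleR_conv_of_real)

lemma bounded_linear_scaleC: "bounded_linear (scaleC c :: 'a::chilbert \<Rightarrow> 'a)"
proof (rule bounded_linear_intro[of _ "cmod c"])
  show "scaleC c (scaleR r x) = scaleR r (scaleC c x)" for r and x :: 'a
    by (simp add: scaleC_of_real[symmetric] mult.commute)
qed (simp_all add: scaleC_add_right norm_scaleC mult.commute)

lemma parallelogram_law:
  "(norm ((x::'a::chilbert) + y))\<^sup>2 + (norm (x - y))\<^sup>2 = 2 * (norm x)\<^sup>2 + 2 * (norm y)\<^sup>2"
  using norm_add_sq[of x y] norm_add_sq[of x "- y"] by (simp add: cinner.minus_right)

lemma cinner_eq_on_dense:
  assumes eq: "\<And>s. s \<in> S \<Longrightarrow> cinner x s = cinner y s" and closure: "x - y \<in> closure S"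
  shows "x = (y::'a::chilbert)"
proof -
  have "closure S \<subseteq> {z. cinner (x - y) z = 0}"
    by (rule closure_minimal)
      (auto simp: eq cinner.diff_left intro!: closed_Collect_eq cinner.continuous_on continuous_intros)
  then have "cinner (x - y) (x - y) = 0" using closure by blast
  then show ?thesis by (simp add: cinner_self_eq_0)
qed

lemma cinner_eqI: "(\<And>s. cinner x s = cinner y s) \<Longrightarrow> x = (y::'a::chilbert)"
  by (rule cinner_eq_on_dense[of UNIV]) auto

lemma closure_invariant:
  assumes "bounded_linear f" "f ` S \<subseteq> S"
  shows "f ` closure S \<subseteq> closure S"
  using closure_bounded_linear_image_subset[OF assms(1)] closure_mono[OF assms(2)] by (rule order_trans)

lemma csubspace_closure:
  assumes S: "csubspace S" shows "csubspace (closure S)"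
  unfolding csubspace_def
proof (intro conjI ballI allI)
  show "0 \<in> closure S" using csubspace_0[OF S] closure_subset by auto
next
  fix x y assume "x \<in> closure S" "y \<in> closure S"
  then obtain f g where "\<forall>n. f n \<in> S" "f \<longlonglongrightarrow> x" "\<forall>n. g n \<in> S" "g \<longlonglongrightarrow> y"
    by (auto simp: closure_sequential)
  then show "x + y \<in> closure S"
    using csubspace_add[OF S]
    by (auto simp: closure_sequential intro!: exI[of _ "\<lambda>n. f n + g n"] tendsto_add)
next
  fix c x assume "x \<in> closure S"
  moreover have "scaleC c ` S \<subseteq> S" using csubspace_scaleC[OF S] by auto
  ultimately show "scaleC c x \<in> closure S" using closure_invariant[OF bounded_linear_scaleC] by blast
qed

subsection \<open>Orthogonal projections\<close>

lemma convex_near_minimizers_close: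
  fixes S :: "'a::chilbert set"
  assumes S: "convex S" "x \<in> S" "y \<in> S"
  shows "(dist x y)\<^sup>2 \<le> 2 * (dist z x)\<^sup>2 + 2 * (dist z y)\<^sup>2 - 4 * (infdist z S)\<^sup>2"
proof -
  define m where "m = scaleR (1/2) x + scaleR (1/2) y"
  have "m \<in> S" unfolding m_def by (rule convexD[OF S]) auto
  then have "infdist z S \<le> norm (z - m)" using infdist_le by (metis dist_norm)
  then have "(infdist z S)\<^sup>2 \<le> (norm (z - m))\<^sup>2" by (intro power_mono infdist_nonneg)
  moreover have "(z - x) + (z - y) = scaleR 2 (z - m)"
    by (simp add: m_def algebra_simps scaleR_2)
  then have "(norm ((z - x) + (z - y)))\<^sup>2 = 4 * (norm (z - m))\<^sup>2" by (simp add: power_mult_distrib)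
  moreover have "norm ((z - x) - (z - y)) = dist x y" by (simp add: dist_norm norm_minus_commute)
  ultimately show ?thesis using parallelogram_law[of "z - x" "z - y"] by (simp add: dist_norm)
qed

lemma convex_minimizing_sequence_Cauchy:
  fixes S :: "'a::chilbert set"
  assumes S: "convex S" and f: "\<And>n. f n \<in> S" "(\<lambda>n. dist z (f n)) \<longlonglongrightarrow> infdist z S"
  shows "Cauchy f"
proof (rule metric_CauchyI)
  fix e :: real assume e: "e > 0"
  have "(\<lambda>n. (dist z (f n))\<^sup>2) \<longlonglongrightarrow> (infdist z S)\<^sup>2" by (intro tendsto_intros f)
  then have "eventually (\<lambda>n. (dist z (f n))\<^sup>2 < (infdist z S)\<^sup>2 + e\<^sup>2 / 4) sequentially"
    by (rule order_tendstoD) (use e in simp)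
  then obtain N where N: "\<And>n. n \<ge> N \<Longrightarrow> (dist z (f n))\<^sup>2 < (infdist z S)\<^sup>2 + e\<^sup>2 / 4"
    by (auto simp: eventually_sequentially)
  have "dist (f m) (f n) < e" if "m \<ge> N" "n \<ge> N" for m n
  proof -
    have "(dist (f m) (f n))\<^sup>2 < e\<^sup>2"
      using convex_near_minimizers_close[OF S f(1,1), of m n z] N[OF that(1)] N[OF that(2)] by simp
    then show ?thesis using e by (simp add: power_less_imp_less_base)
  qed
  then show "\<exists>N. \<forall>m\<ge>N. \<forall>n\<ge>N. dist (f m) (f n) < e" by blast
qed

lemma closed_convex_infdist_attained:
  fixes S :: "'a::chilbert set"
  assumes S: "convex S" "closed S" "S \<noteq> {}"
  shows "\<exists>p\<in>S. dist z p = infdist z S"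
proof -
  have "Inf (dist z ` S) \<in> closure (dist z ` S)"
    by (rule closure_contains_Inf) (use S in \<open>auto intro: bdd_belowI2[of _ 0]\<close>)
  then have "infdist z S \<in> closure (dist z ` S)" using S by (simp add: infdist_notempty)
  then obtain g where g: "\<And>n. g n \<in> dist z ` S" "g \<longlonglongrightarrow> infdist z S"
    by (auto simp: closure_sequential)
  have "\<forall>n. \<exists>s\<in>S. g n = dist z s" using g(1) by blast
  then obtain f where f: "\<And>n. f n \<in> S" "\<And>n. g n = dist z (f n)" by metis
  then have lim: "(\<lambda>n. dist z (f n)) \<longlonglongrightarrow> infdist z S" using g(2) by presburger
  have "Cauchy f" by (rule convex_minimizing_sequence_Cauchy[OF S(1) f(1) lim])
  then obtain p where p: "f \<longlonglongrightarrow> p" using Cauchy_convergent convergent_def by blast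
  have "p \<in> S" using closed_sequentially[OF S(2)] f(1) p by blast
  moreover have "dist z p = infdist z S" by (rule LIMSEQ_unique[OF _ lim]) (intro tendsto_intros p)
  ultimately show ?thesis by blast
qed

lemma orthogonal_decomposition:
  fixes S :: "'a::chilbert set"
  assumes S: "csubspace S" "closed S"
  shows "\<exists>p\<in>S. \<forall>s\<in>S. cinner (z - p) s = 0"
proof -
  have "convex S" "S \<noteq> {}"
    using csubspace_imp_subspace[OF S(1)] subspace_imp_convex csubspace_0[OF S(1)] by auto
  then obtain p where p: "p \<in> S" "dist z p = infdist z S"
    using closed_convex_infdist_attained S(2) by blast
  have "cinner (z - p) s = 0" if s: "s \<in> S" for s
  proof (cases "s = 0")
    case False
    let ?a = "cinner (z - p) s / (norm s)\<^sup>2"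
    have "p + scaleC ?a s \<in> S" by (intro csubspace_add csubspace_scaleC S p s)
    then have "norm (z - p) \<le> norm (z - p - scaleC ?a s)"
      using p(2) infdist_le[of "p + scaleC ?a s" S z] by (simp add: dist_norm diff_diff_eq)
    then have "(norm (z - p))\<^sup>2 \<le> (norm (z - p))\<^sup>2 - (cmod (cinner (z - p) s))\<^sup>2 / (norm s)\<^sup>2"
      unfolding norm_sq_diff_component[OF False, symmetric] by (rule power_mono) simp
    then have "(cmod (cinner (z - p) s))\<^sup>2 / (norm s)\<^sup>2 \<le> 0" by simp
    then show ?thesis using False by (simp add: divide_le_0_iff)
  qed (simp add: cinner.zero_right)
  then show ?thesis using p(1) by blast
qed

definition oproj :: "'a::chilbert set \<Rightarrow> 'a \<Rightarrow> 'a" where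
  "oproj S z = (SOME p. p \<in> S \<and> (\<forall>s\<in>S. cinner (z - p) s = 0))"

lemma
  assumes "csubspace S" "closed S"
  shows oproj_in: "oproj S z \<in> S" and oproj_orthogonal: "s \<in> S \<Longrightarrow> cinner (z - oproj S z) s = 0"
proof -
  have "oproj S z \<in> S \<and> (\<forall>s\<in>S. cinner (z - oproj S z) s = 0)"
    unfolding oproj_def by (rule someI_ex) (use orthogonal_decomposition[OF assms] in blast)
  then show "oproj S z \<in> S" "s \<in> S \<Longrightarrow> cinner (z - oproj S z) s = 0" by auto
qed

lemma oproj_unique:
  assumes S: "csubspace S" "closed S" and p: "p \<in> S" "\<And>s. s \<in> S \<Longrightarrow> cinner (z - p) s = 0"
  shows "oproj S z = p"
proof (rule cinner_eq_on_dense[of S])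
  show "cinner (oproj S z) s = cinner p s" if "s \<in> S" for s
    using oproj_orthogonal[OF S that, of z] p(2)[OF that] by (simp add: cinner.diff_left)
  show "oproj S z - p \<in> closure S"
    using csubspace_diff[OF S(1) oproj_in[OF S] p(1)] closure_subset by blast
qed

lemma oproj_id: "csubspace S \<Longrightarrow> closed S \<Longrightarrow> p \<in> S \<Longrightarrow> oproj S p = p"
  by (rule oproj_unique) (auto simp: cinner.zero_left)

lemma norm_oproj_le:
  assumes S: "csubspace S" "closed S"
  shows "norm (oproj S x) \<le> norm x"
proof (rule power2_le_imp_le)
  have "cinner (x - oproj S x) (oproj S x) = 0" using oproj_orthogonal[OF S oproj_in[OF S]] .
  then have "(norm x)\<^sup>2 = (norm (x - oproj S x))\<^sup>2 + (norm (oproj S x))\<^sup>2"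
    using norm_add_sq[of "x - oproj S x" "oproj S x"] by simp
  then show "(norm (oproj S x))\<^sup>2 \<le> (norm x)\<^sup>2" by simp
qed simp

subsection \<open>Bounded operators and adjoints\<close>

lemma bop_add: "bop K A \<Longrightarrow> x \<in> K \<Longrightarrow> y \<in> K \<Longrightarrow> A (x + y) = A x + A y"
  and bop_scaleC: "bop K A \<Longrightarrow> x \<in> K \<Longrightarrow> A (scaleC c x) = scaleC c (A x)"
  and bop_in: "bop K A \<Longrightarrow> x \<in> K \<Longrightarrow> A x \<in> K"
  by (auto simp: bop_def clinear_on_def)

lemma norm_bound_pos:
  assumes "\<And>x. x \<in> K \<Longrightarrow> norm (f x) \<le> b * norm x"
  obtains c where "c > 0" "\<And>x. x \<in> K \<Longrightarrow> norm (f x) \<le> c * norm x"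
proof
  show "norm (f x) \<le> (\<bar>b\<bar> + 1) * norm x" if "x \<in> K" for x
    using order_trans[OF assms[OF that], of "(\<bar>b\<bar> + 1) * norm x"] by (simp add: mult_right_mono)
qed simp

lemma bop_bound:
  assumes "bop K A" obtains c where "c > 0" "\<And>x. x \<in> K \<Longrightarrow> norm (A x) \<le> c * norm x"
  using assms norm_bound_pos[of K A] unfolding bop_def by metis

lemma bop_UNIV_iff:
  "bop UNIV A \<longleftrightarrow> bounded_linear A \<and> (\<forall>c x. A (scaleC c x) = scaleC c (A x))"
proof
  assume A: "bop UNIV A"
  obtain c where "\<And>x. norm (A x) \<le> c * norm x" using bop_bound[OF A] by auto
  then show "bounded_linear A \<and> (\<forall>c x. A (scaleC c x) = scaleC c (A x))"
    using bop_add[OF A] bop_scaleC[OF A]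
    by (auto simp: scaleC_of_real[symmetric] mult.commute intro!: bounded_linear_intro[of _ c])
next
  assume A: "bounded_linear A \<and> (\<forall>c x. A (scaleC c x) = scaleC c (A x))"
  then obtain c where "\<And>x. norm (A x) \<le> c * norm x"
    using bounded_linear.bounded by (metis mult.commute)
  then show "bop UNIV A"
    using A by (auto simp: bop_def ext_on_def clinear_on_def linear_simps(1))
qed

lemma bop_UNIV_I:
  assumes "\<And>x y. A (x + y) = A x + A y" "\<And>c x. A (scaleC c x) = scaleC c (A x)"
    "\<And>x. norm (A x) \<le> b * norm x"
  shows "bop UNIV A"
  using assms unfolding bop_def ext_on_def clinear_on_def by blast

lemma bop_UNIV_bounded_linear: "bop UNIV A \<Longrightarrow> bounded_linear A"
  by (simp add: bop_UNIV_iff)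

lemma bop_UNIV_tendsto: "bop UNIV A \<Longrightarrow> (f \<longlongrightarrow> x) F \<Longrightarrow> ((\<lambda>y. A (f y)) \<longlongrightarrow> A x) F"
  by (rule bounded_linear.tendsto[OF bop_UNIV_bounded_linear])

lemma bop_UNIV_continuous_on: "bop UNIV A \<Longrightarrow> continuous_on S A"
  by (rule linear_continuous_on[OF bop_UNIV_bounded_linear])

lemma bop_UNIV_zero: "bop UNIV A \<Longrightarrow> A 0 = 0"
  and bop_UNIV_diff: "bop UNIV A \<Longrightarrow> A (x - y) = A x - A y"
  by (simp_all add: bop_UNIV_iff linear_simps)

lemma bop_UNIV_comp: "bop UNIV A \<Longrightarrow> bop UNIV B \<Longrightarrow> bop UNIV (\<lambda>x. A (B x))"
  by (simp add: bop_UNIV_iff bounded_linear_compose)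

lemma bop_UNIV_id: "bop UNIV (\<lambda>x::'a::chilbert. x)"
  by (simp add: bop_UNIV_iff)

lemma bop_restr:
  assumes K: "csubspace K" and A: "bop UNIV A" and invariant: "A ` K \<subseteq> K"
  shows "bop K (restr K A)"
proof -
  obtain c where "\<And>x. norm (A x) \<le> c * norm x" using bop_bound[OF A] by auto
  then have "\<exists>c. \<forall>x\<in>K. norm (restr K A x) \<le> c * norm x" by (auto simp: restr_def)
  moreover have "clinear_on K (restr K A)"
    by (simp add: clinear_on_def restr_def csubspace_add[OF K] csubspace_scaleC[OF K]
        bop_add[OF A] bop_scaleC[OF A])
  ultimately show ?thesis using invariant by (auto simp: bop_def ext_on_def restr_def)
qed

lemma bop_eq_on_dense:
  assumes A: "bop UNIV A" and B: "bop UNIV B" and D: "closure D = UNIV"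
    and eq: "\<And>x. x \<in> D \<Longrightarrow> A x = B x"
  shows "A = B"
proof -
  have "closure D \<subseteq> {x. A x = B x}"
    by (rule closure_minimal) (use eq in \<open>auto intro!: closed_Collect_eq bop_UNIV_continuous_on A B\<close>)
  then show ?thesis using D by auto
qed

lemma bop_oproj:
  assumes S: "csubspace S" "closed S"
  shows "bop UNIV (oproj S)"
proof (rule bop_UNIV_I[of _ 1])
  show "oproj S (x + y) = oproj S x + oproj S y" for x y
  proof (rule oproj_unique[OF S])
    show "oproj S x + oproj S y \<in> S" by (intro csubspace_add oproj_in S)
    show "cinner (x + y - (oproj S x + oproj S y)) s = 0" if s: "s \<in> S" for s
      using oproj_orthogonal[OF S s] by (simp add: add_diff_add cinner_add_left)
  qed
  show "oproj S (scaleC c x) = scaleC c (oproj S x)" for c x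
    by (rule oproj_unique[OF S])
      (simp_all add: csubspace_scaleC oproj_in oproj_orthogonal S cinner_scaleC_left
        complex_vector.scale_right_diff_distrib[symmetric])
qed (simp add: norm_oproj_le[OF S])

lemma riesz_representation:
  fixes f :: "'a::chilbert \<Rightarrow> complex"
  assumes f: "bounded_linear f" and scale: "\<And>c x. f (scaleC c x) = c * f x"
  shows "\<exists>z. \<forall>x. f x = cinner x z"
proof (cases "\<forall>x. f x = 0")
  case True then show ?thesis by (intro exI[of _ 0]) (simp add: cinner.zero_right)
next
  case False
  interpret f: bounded_linear f by fact
  define N where "N = {x. f x = 0}"
  have N: "csubspace N" by (auto simp: N_def csubspace_def f.zero f.add scale)
  have N_closed: "closed N"
    unfolding N_def by (intro closed_Collect_eq f.continuous_on continuous_intros)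
  obtain u where "f u \<noteq> 0" using False by blast
  define w where "w = u - oproj N u"
  have fw: "f w \<noteq> 0" using oproj_in[OF N N_closed, of u] \<open>f u \<noteq> 0\<close> by (simp add: w_def N_def f.diff)
  have w_orthogonal: "cinner w s = 0" if "f s = 0" for s
    unfolding w_def by (rule oproj_orthogonal[OF N N_closed]) (use that in \<open>simp add: N_def\<close>)
  have "f x = cinner x (scaleC (cnj (f w) / (norm w)\<^sup>2) w)" for x
  proof -
    have "cinner w (x - scaleC (f x / f w) w) = 0"
      by (rule w_orthogonal) (use fw in \<open>simp add: f.diff scale\<close>)
    then have "cinner x w = f x / f w * (norm w)\<^sup>2"
      by (subst cinner_commute)
        (simp add: cinner.diff_right cinner_scaleC_right cinner_self)
    then show ?thesis using fw f.zero by (auto simp: cinner_scaleC_right)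
  qed
  then show ?thesis by blast
qed

abbreviation adj :: "('a::chilbert \<Rightarrow> 'a) \<Rightarrow> 'a \<Rightarrow> 'a" where
  "adj \<equiv> badj UNIV"

lemma cinner_adj_right:
  assumes A: "bop UNIV A"
  shows "cinner (A x) y = cinner x (adj A y)"
proof -
  have "bounded_linear (\<lambda>x. cinner (A x) y)"
    by (intro bounded_linear_compose[OF cinner.bounded_linear_left] bop_UNIV_bounded_linear A)
  then obtain z where z: "\<forall>x. cinner (A x) y = cinner x z"
    using riesz_representation[of "\<lambda>x. cinner (A x) y"]
    by (auto simp: bop_scaleC[OF A] cinner_scaleC_left)
  moreover have "z' = z" if "\<forall>x. cinner (A x) y = cinner x z'" for z'
    by (rule cinner_eqI) (metis that z cinner_commute)
  ultimately have "(THE z. \<forall>x. cinner (A x) y = cinner x z) = z" by (intro the_equality)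
  then show ?thesis using z by (simp add: badj_def)
qed

lemma cinner_adj_left: "bop UNIV A \<Longrightarrow> cinner (adj A x) y = cinner x (A y)"
  by (metis cinner_commute cinner_adj_right)

lemma adj_eqI:
  assumes A: "bop UNIV A" and B: "\<And>x y. cinner (A x) y = cinner x (B y)"
  shows "adj A = B"
proof
  show "adj A x = B x" for x
    by (rule cinner_eqI) (metis cinner_adj_left[OF A] B cinner_commute)
qed

lemma norm_adj_le:
  assumes A: "bop UNIV A" and b: "\<And>x. norm (A x) \<le> b * norm x" "b \<ge> 0"
  shows "norm (adj A x) \<le> b * norm x"
proof -
  let ?n = "norm (adj A x)"
  have "?n * ?n = cmod (cinner (A (adj A x)) x)"
    by (simp add: cinner_adj_right[OF A] norm_sq_eq_cmod_cinner power2_eq_square[symmetric])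
  also have "\<dots> \<le> norm (A (adj A x)) * norm x" by (rule cinner_Cauchy_Schwarz)
  also have "\<dots> \<le> (b * ?n) * norm x" by (intro mult_right_mono b) simp
  finally have "?n * ?n \<le> ?n * (b * norm x)" by (simp add: mult_ac)
  then show "?n \<le> b * norm x" using b(2) by (cases "?n = 0") (auto simp: mult_le_cancel_left)
qed

lemma bop_adj:
  assumes A: "bop UNIV A"
  shows "bop UNIV (adj A)"
proof -
  obtain b where b: "b > 0" "\<And>x. norm (A x) \<le> b * norm x" using bop_bound[OF A] by auto
  show ?thesis
  proof (rule bop_UNIV_I[of _ b])
    show "adj A (x + y) = adj A x + adj A y" for x y
      by (rule cinner_eqI) (simp add: cinner_add_left cinner_adj_left[OF A])
    show "adj A (scaleC c x) = scaleC c (adj A x)" for c x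
      by (rule cinner_eqI) (simp add: cinner_scaleC_left cinner_adj_left[OF A])
    show "norm (adj A x) \<le> b * norm x" for x using norm_adj_le[OF A b(2)] b(1) by simp
  qed
qed

lemma oproj_commute:
  assumes S: "csubspace S" "closed S" and A: "bop UNIV A"
    and invariant: "A ` S \<subseteq> S" "adj A ` S \<subseteq> S"
  shows "oproj S (A x) = A (oproj S x)"
proof (rule oproj_unique[OF S])
  show "A (oproj S x) \<in> S" using invariant(1) oproj_in[OF S] by blast
  show "cinner (A x - A (oproj S x)) s = 0" if "s \<in> S" for s
  proof -
    have "cinner (A x - A (oproj S x)) s = cinner (x - oproj S x) (adj A s)"
      by (simp add: bop_UNIV_diff[OF A, symmetric] cinner_adj_right[OF A])
    also have "\<dots> = 0" by (rule oproj_orthogonal[OF S]) (use that invariant(2) in blast)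
    finally show ?thesis .
  qed
qed

lemma is_projection_bop: "is_projection UNIV E \<Longrightarrow> bop UNIV E"
  and is_projection_idem: "is_projection UNIV E \<Longrightarrow> E (E x) = E x"
  by (simp_all add: is_projection_def)

lemma cinner_is_projection: "is_projection UNIV E \<Longrightarrow> cinner (E x) y = cinner x (E y)"
  using cinner_adj_right[of E x y] by (simp add: is_projection_def)

lemma range_is_projection: "is_projection UNIV E \<Longrightarrow> range E = {x. E x = x}"
  by (auto simp: is_projection_idem intro: range_eqI[OF sym])

lemma hilbert_sub_range_projection:
  assumes E: "is_projection UNIV E"
  shows "hilbert_sub (range E)"
  unfolding hilbert_sub_def range_is_projection[OF E]
proof
  note bop_E = is_projection_bop[OF E]
  show "csubspace {x. E x = x}"
    by (simp add: csubspace_def bop_UNIV_zero[OF bop_E] bop_add[OF bop_E] bop_scaleC[OF bop_E])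
  show "closed {x. E x = x}"
    by (intro closed_Collect_eq bop_UNIV_continuous_on bop_E continuous_intros)
qed

lemma bop_comp_projection:
  assumes E: "is_projection UNIV E" and C: "bop (range E) C"
  shows "bop UNIV (\<lambda>x. C (E x))"
proof -
  note bop_E = is_projection_bop[OF E]
  obtain c where c: "c > 0" "\<And>x. x \<in> range E \<Longrightarrow> norm (C x) \<le> c * norm x"
    using bop_bound[OF C] by blast
  obtain b where b: "\<And>x. norm (E x) \<le> b * norm x" using bop_bound[OF bop_E] by auto
  show ?thesis
  proof (rule bop_UNIV_I[of _ "c * b"])
    show "norm (C (E x)) \<le> c * b * norm x" for x
      using order_trans[OF c(2)[OF rangeI] mult_left_mono[OF b[of x], of c]] c(1)
      by (simp add: mult.assoc)
  qed (simp_all add: bop_add[OF bop_E] bop_add[OF C] bop_scaleC[OF bop_E] bop_scaleC[OF C])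
qed

subsection \<open>Closed graphs\<close>

instantiation prod :: (chilbert, chilbert) chilbert
begin

definition "scaleC c x = (scaleC c (fst x), scaleC c (snd x))"
definition "cinner x y = cinner (fst x) (fst y) + cinner (snd x) (snd y)"

instance
proof
  fix r a b c and x y z :: "'a \<times> 'b"
  have self: "cinner x x = complex_of_real ((norm (fst x))\<^sup>2 + (norm (snd x))\<^sup>2)"
    by (simp add: cinner_prod_def cinner_self)
  show "Im (cinner x x) = 0 \<and> Re (cinner x x) \<ge> 0" by (simp add: self)
  show "(cinner x x = 0) = (x = 0)"
    by (simp only: self of_real_eq_0_iff sum_power2_eq_zero_iff) (simp add: prod_eq_iff)
  show "norm x = sqrt (Re (cinner x x))" by (simp add: self norm_prod_def)
  show "cinner x y = cnj (cinner y x)"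
    unfolding cinner_prod_def by (metis cinner_commute complex_cnj_add)
qed (simp_all add: scaleC_prod_def cinner_prod_def scaleR_prod_def scaleC_of_real scaleC_add_right
      scaleC_add_left cinner_add_left cinner_scaleC_left distrib_left)

end

lemma bop_map_prod:
  assumes A: "bop UNIV A" and B: "bop UNIV B"
  shows "bop UNIV (map_prod A B)"
proof -
  have "bounded_linear (\<lambda>x. (A (fst x), B (snd x)))"
    by (intro bounded_linear_Pair)
      (auto intro: bounded_linear_compose[OF bop_UNIV_bounded_linear] A B
        bounded_linear_fst bounded_linear_snd)
  then show ?thesis
    using assms by (simp add: bop_UNIV_iff map_prod_def case_prod_unfold scaleC_prod_def)
qed

lemma adj_map_prod:
  assumes "bop UNIV A" "bop UNIV B"
  shows "adj (map_prod A B) = map_prod (adj A) (adj B)"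
  by (rule adj_eqI) (simp_all add: bop_map_prod assms cinner_prod_def cinner_adj_right)

lemma csubspace_graph:
  assumes D: "csubspace D" and X: "clinear_on D X"
  shows "csubspace ((\<lambda>\<zeta>. (\<zeta>, X \<zeta>)) ` D)"
proof -
  have "(\<lambda>\<zeta>. (\<zeta>, X \<zeta>)) ` D = {z. fst z \<in> D \<and> snd z = X (fst z)}" by force
  then show ?thesis
    using csubspace_0[OF D] csubspace_add[OF D] csubspace_scaleC[OF D] clinear_on_0[OF D X]
      clinear_on_add[OF X] clinear_on_scaleC[OF X]
    by (auto simp: csubspace_def scaleC_prod_def)
qed

locale bounded_graph =
  fixes G :: "('a::chilbert \<times> 'a) set" and c :: real
  assumes csubspace_G: "csubspace G" and closed_G: "closed G"
    and c_nonneg: "c \<ge> 0" and bound: "(x, y) \<in> G \<Longrightarrow> norm y \<le> c * norm x"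
begin

lemma csubspace_Domain: "csubspace (Domain G)"
  unfolding csubspace_def
proof (intro conjI ballI allI)
  show "0 \<in> Domain G" using csubspace_0[OF csubspace_G] by (auto simp: zero_prod_def)
next
  fix x y assume "x \<in> Domain G" "y \<in> Domain G"
  then show "x + y \<in> Domain G" using csubspace_add[OF csubspace_G] by fastforce
next
  fix k x assume "x \<in> Domain G"
  then show "scaleC k x \<in> Domain G"
    using csubspace_scaleC[OF csubspace_G, of _ k] by (fastforce simp: scaleC_prod_def)
qed

lemma closed_Domain: "closed (Domain G)"
  unfolding Domain_fst
proof (rule complete_imp_closed, rule complete_isometric_image)
  show "1 / (1 + c) > 0" using c_nonneg by simp
  show "\<forall>z\<in>G. norm (fst z) \<ge> 1 / (1 + c) * norm z"
  proof
    fix z assume "z \<in> G"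
    then have "norm z \<le> norm (fst z) + c * norm (fst z)"
      using norm_Pair_le[of "fst z" "snd z"] bound[of "fst z" "snd z"] by simp
    then show "norm (fst z) \<ge> 1 / (1 + c) * norm z" using c_nonneg by (simp add: field_simps)
  qed
  show "complete G" using closed_G by (simp add: complete_eq_closed)
qed (rule csubspace_imp_subspace[OF csubspace_G] bounded_linear_fst)+

definition graph_op :: "'a \<Rightarrow> 'a" where
  "graph_op x = (THE y. (oproj (Domain G) x, y) \<in> G)"

lemma single_valued: "(x, y) \<in> G \<Longrightarrow> (x, y') \<in> G \<Longrightarrow> y = y'"
  using csubspace_diff[OF csubspace_G, of "(x, y)" "(x, y')"] bound[of 0 "y - y'"] by simp

lemma graph_op_eqI: "(oproj (Domain G) x, y) \<in> G \<Longrightarrow> graph_op x = y"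
  unfolding graph_op_def by (rule the_equality) (auto intro: single_valued)

lemma graph_op_in: "(oproj (Domain G) x, graph_op x) \<in> G"
  using oproj_in[OF csubspace_Domain closed_Domain, of x] graph_op_eqI by auto

lemma graph_op_eq: "(x, y) \<in> G \<Longrightarrow> graph_op x = y"
  by (rule graph_op_eqI) (simp add: oproj_id[OF csubspace_Domain closed_Domain] DomainI)

lemma bop_graph_op: "bop UNIV graph_op"
proof (rule bop_UNIV_I[of _ c])
  note bop_P = bop_oproj[OF csubspace_Domain closed_Domain]
  show "graph_op (x + y) = graph_op x + graph_op y" for x y
    using csubspace_add[OF csubspace_G graph_op_in graph_op_in, of x y]
    by (intro graph_op_eqI) (simp add: bop_add[OF bop_P])
  show "graph_op (scaleC k x) = scaleC k (graph_op x)" for k x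
    using csubspace_scaleC[OF csubspace_G graph_op_in, of k x]
    by (intro graph_op_eqI) (simp add: bop_scaleC[OF bop_P] scaleC_prod_def)
  show "norm (graph_op x) \<le> c * norm x" for x
    using order_trans[OF bound[OF graph_op_in]]
      mult_left_mono[OF norm_oproj_le[OF csubspace_Domain closed_Domain] c_nonneg] .
qed

lemma graph_op_commute:
  assumes A: "bop UNIV A" and invariant: "map_prod A A ` G \<subseteq> G" "map_prod (adj A) (adj A) ` G \<subseteq> G"
  shows "graph_op (A x) = A (graph_op x)"
proof (rule graph_op_eqI)
  have "oproj (Domain G) (A x) = A (oproj (Domain G) x)"
    by (rule oproj_commute[OF csubspace_Domain closed_Domain A]) (use invariant in \<open>fastforce+\<close>)
  then show "(oproj (Domain G) (A x), A (graph_op x)) \<in> G"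
    using invariant(1) graph_op_in[of x] by force
qed

end

lemma bounded_graph_closure:
  assumes G: "csubspace G" and c: "c \<ge> 0" and bound: "\<And>x y. (x, y) \<in> G \<Longrightarrow> norm y \<le> c * norm x"
  shows "bounded_graph (closure G) c"
proof
  have "closure G \<subseteq> {z. norm (snd z) \<le> c * norm (fst z)}"
    by (rule closure_minimal) (use bound in \<open>auto intro!: closed_Collect_le continuous_intros\<close>)
  then show "norm y \<le> c * norm x" if "(x, y) \<in> closure G" for x y using that by auto
qed (simp_all add: csubspace_closure[OF G] c)

lemma bounded_operator_extension:
  assumes S: "csubspace S" and f: "clinear_on S f" and bound: "\<And>x. x \<in> S \<Longrightarrow> norm (f x) \<le> b * norm x"
  shows "\<exists>A. bop UNIV A \<and> (\<forall>x\<in>S. A x = f x)"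
proof -
  obtain c where c: "c > 0" "\<And>x. x \<in> S \<Longrightarrow> norm (f x) \<le> c * norm x"
    using norm_bound_pos[OF bound] by blast
  interpret bounded_graph "closure ((\<lambda>x. (x, f x)) ` S)" c
    by (rule bounded_graph_closure) (use csubspace_graph[OF S f] c in auto)
  have "graph_op x = f x" if "x \<in> S" for x
    using graph_op_eq[OF subsetD[OF closure_subset imageI[OF that]]] .
  then show ?thesis using bop_graph_op by blast
qed

section \<open>Commutants\<close>

definition star_closed :: "('a::chilbert \<Rightarrow> 'a) set \<Rightarrow> bool" where
  "star_closed S \<longleftrightarrow> (\<forall>A\<in>S. bop UNIV A \<and> adj A \<in> S)"

lemma star_closed_bop: "star_closed S \<Longrightarrow> A \<in> S \<Longrightarrow> bop UNIV A"
  and star_closed_adj: "star_closed S \<Longrightarrow> A \<in> S \<Longrightarrow> adj A \<in> S"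
  by (simp_all add: star_closed_def)

lemma bcomm_bop: "A \<in> bcomm K S \<Longrightarrow> bop K A"
  and bcomm_commute: "A \<in> bcomm K S \<Longrightarrow> C \<in> S \<Longrightarrow> x \<in> K \<Longrightarrow> A (C x) = C (A x)"
  by (auto simp: bcomm_def)

lemma bcomm_id: "(\<lambda>x. x) \<in> bcomm UNIV S"
  by (simp add: bcomm_def bop_UNIV_id)

lemma bcomm_comp: "A \<in> bcomm UNIV S \<Longrightarrow> B \<in> bcomm UNIV S \<Longrightarrow> (\<lambda>x. A (B x)) \<in> bcomm UNIV S"
  by (simp add: bcomm_def bop_UNIV_comp)

lemma star_closed_bcomm:
  assumes S: "star_closed S"
  shows "star_closed (bcomm UNIV S)"
  unfolding star_closed_def
proof (intro ballI conjI)
  fix A assume A: "A \<in> bcomm UNIV S"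
  show bop_A: "bop UNIV A" using A by (rule bcomm_bop)
  have "adj A (C x) = C (adj A x)" if C: "C \<in> S" for C x
  proof (rule cinner_eqI)
    fix y
    note bop_C = star_closed_bop[OF S C]
    have "cinner (adj A (C x)) y = cinner x (adj C (A y))"
      by (simp add: cinner_adj_left[OF bop_A] cinner_adj_right[OF bop_C])
    also have "\<dots> = cinner x (A (adj C y))"
      using bcomm_commute[OF A star_closed_adj[OF S C]] by simp
    also have "\<dots> = cinner (C (adj A x)) y"
      by (simp add: cinner_adj_left[OF bop_A] cinner_adj_right[OF bop_C])
    finally show "cinner (adj A (C x)) y = cinner (C (adj A x)) y" .
  qed
  then show "adj A \<in> bcomm UNIV S" by (simp add: bcomm_def bop_adj[OF bop_A])
qed

lemma amplification_commuting_entry_in_bcomm: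
  fixes P :: "'a \<times> 'a::chilbert \<Rightarrow> 'a \<times> 'a" and pr :: "'a \<times> 'a \<Rightarrow> 'a"
  assumes S: "\<And>C. C \<in> S \<Longrightarrow> bop UNIV C"
    and P: "bop UNIV P" and commute: "\<And>C z. C \<in> S \<Longrightarrow> P (map_prod C C z) = map_prod C C (P z)"
    and pr: "pr = fst \<or> pr = snd" and i: "i = (\<lambda>x. (x, 0)) \<or> i = (\<lambda>x. (0, x))"
  shows "(\<lambda>x. pr (P (i x))) \<in> bcomm UNIV S"
proof -
  have bounded_linear: "bounded_linear pr" "bounded_linear i"
    using pr i by (auto intro: bounded_linear_fst bounded_linear_snd bounded_linear_Pair
        bounded_linear_ident bounded_linear_zero)
  have "bounded_linear (\<lambda>x. pr (P (i x)))"
    by (intro bounded_linear_compose[OF bounded_linear(1)]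
        bounded_linear_compose[OF bop_UNIV_bounded_linear[OF P]] bounded_linear(2))
  moreover have "pr (P (i (scaleC c x))) = scaleC c (pr (P (i x)))" for c x
  proof -
    have "i (scaleC c x) = scaleC c (i x)" using i by (auto simp: scaleC_prod_def)
    moreover have "pr (scaleC c z) = scaleC c (pr z)" for z using pr by (auto simp: scaleC_prod_def)
    ultimately show ?thesis by (simp add: bop_scaleC[OF P])
  qed
  moreover have "pr (P (i (C x))) = C (pr (P (i x)))" if C: "C \<in> S" for C x
  proof -
    have "i (C x) = map_prod C C (i x)" using i by (auto simp: bop_UNIV_zero[OF S[OF C]])
    then show ?thesis using pr by (auto simp: commute[OF C])
  qed
  ultimately show ?thesis by (simp add: bcomm_def bop_UNIV_iff)
qed

lemma bicommutant_amplification_commute: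
  fixes P :: "'a \<times> 'a::chilbert \<Rightarrow> 'a \<times> 'a"
  assumes S: "\<And>C. C \<in> S \<Longrightarrow> bop UNIV C"
    and P: "bop UNIV P" and commute: "\<And>C z. C \<in> S \<Longrightarrow> P (map_prod C C z) = map_prod C C (P z)"
    and T: "T \<in> bcomm UNIV (bcomm UNIV S)"
  shows "P (map_prod T T z) = map_prod T T (P z)"
proof -
  have coordinate: "pr (P (T x, T y)) = T (pr (P (x, y)))"
    if pr: "pr = fst \<or> pr = snd" for pr :: "'a \<times> 'a \<Rightarrow> 'a" and x y
  proof -
    note T_entry = bcomm_commute[OF T amplification_commuting_entry_in_bcomm[OF S P commute pr]]
    have split: "pr (P (u, w)) = pr (P (u, 0)) + pr (P (0, w))" for u w
      using pr bop_add[OF P, of "(u, 0)" "(0, w)"] by auto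
    have "pr (P (T x, 0)) = T (pr (P (x, 0)))" "pr (P (0, T y)) = T (pr (P (0, y)))"
      using T_entry[of "\<lambda>x. (x, 0)" x] T_entry[of "\<lambda>x. (0, x)" y] by auto
    then show ?thesis using split[of "T x" "T y"] split[of x y] bop_add[OF bcomm_bop[OF T]] by simp
  qed
  show ?thesis
    using coordinate[of fst "fst z" "snd z"] coordinate[of snd "fst z" "snd z"]
    by (simp add: prod_eq_iff map_prod_def case_prod_unfold)
qed

lemma bicommutant_invariant_subspace:
  fixes G :: "('a \<times> 'a::chilbert) set"
  assumes S: "star_closed S" and G: "csubspace G" "closed G"
    and invariant: "\<And>C. C \<in> S \<Longrightarrow> map_prod C C ` G \<subseteq> G"
    and T: "T \<in> bcomm UNIV (bcomm UNIV S)"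
  shows "map_prod T T ` G \<subseteq> G"
proof
  fix w assume "w \<in> map_prod T T ` G"
  then obtain z where z: "w = map_prod T T z" "z \<in> G" by (rule imageE)
  have "oproj G (map_prod C C z) = map_prod C C (oproj G z)" if C: "C \<in> S" for C z
  proof (rule oproj_commute[OF G])
    note bop_C = star_closed_bop[OF S C]
    show "bop UNIV (map_prod C C)" by (intro bop_map_prod bop_C)
    show "map_prod C C ` G \<subseteq> G" by (rule invariant[OF C])
    show "adj (map_prod C C) ` G \<subseteq> G"
      unfolding adj_map_prod[OF bop_C bop_C] by (rule invariant[OF star_closed_adj[OF S C]])
  qed
  then have "oproj G (map_prod T T z) = map_prod T T (oproj G z)"
    by (intro bicommutant_amplification_commute[OF star_closed_bop[OF S] bop_oproj[OF G] _ T])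
  then have "oproj G w = w" using z by (simp add: oproj_id[OF G])
  then show "w \<in> G" using oproj_in[OF G] by metis
qed

lemma sstar_closure_strong_limit:
  assumes A: "A \<in> sstar_closure K S" and V: "finite V" "V \<subseteq> K"
  shows "\<exists>B. (\<forall>n. B n \<in> S) \<and> (\<forall>\<xi>\<in>V. (\<lambda>n. B n \<xi>) \<longlonglongrightarrow> A \<xi>)"
proof -
  have "\<forall>n. \<exists>B\<in>S. \<forall>\<xi>\<in>V. norm (A \<xi> - B \<xi>) + norm (badj K (\<lambda>x. A x - B x) \<xi>) < inverse (real (Suc n))"
    using A V unfolding sstar_closure_def by simp
  then obtain B where B: "\<And>n. B n \<in> S"
    "\<And>n \<xi>. \<xi> \<in> V \<Longrightarrow> norm (A \<xi> - B n \<xi>) + norm (badj K (\<lambda>x. A x - B n x) \<xi>) < inverse (real (Suc n))"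
    by metis
  have "(\<lambda>n. B n \<xi>) \<longlonglongrightarrow> A \<xi>" if \<xi>: "\<xi> \<in> V" for \<xi>
  proof (rule LIM_zero_cancel, rule Lim_null_comparison[OF _ LIMSEQ_inverse_real_of_nat])
    have "norm (B n \<xi> - A \<xi>) \<le> inverse (real (Suc n))" for n
      using B(2)[OF \<xi>, of n] norm_ge_zero[of "badj K (\<lambda>x. A x - B n x) \<xi>"]
      by (simp only: norm_minus_commute[of "B n \<xi>"])
    then show "eventually (\<lambda>n. norm (B n \<xi> - A \<xi>) \<le> inverse (real (Suc n))) sequentially" by simp
  qed
  then show ?thesis using B(1) by blast
qed

lemma sstar_closure_eq:
  assumes A: "A \<in> sstar_closure UNIV S" and F: "bop UNIV F" and G: "bop UNIV G"
    and eq: "\<And>B. B \<in> S \<Longrightarrow> F (B x) = G (B y)"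
  shows "F (A x) = G (A y)"
proof -
  obtain B where B: "\<And>n. B n \<in> S" "(\<lambda>n. B n x) \<longlonglongrightarrow> A x" "(\<lambda>n. B n y) \<longlonglongrightarrow> A y"
    using sstar_closure_strong_limit[OF A, of "{x, y}"] by auto
  have "(\<lambda>n. F (B n x)) \<longlonglongrightarrow> F (A x)" by (rule bop_UNIV_tendsto[OF F B(2)])
  moreover have "(\<lambda>n. F (B n x)) \<longlonglongrightarrow> G (A y)"
    unfolding eq[OF B(1)] by (rule bop_UNIV_tendsto[OF G B(3)])
  ultimately show ?thesis by (rule LIMSEQ_unique)
qed

subsection \<open>The commutant of a reduced algebra\<close>

lemma doubling_sequence_le:
  fixes r :: "nat \<Rightarrow> real"
  assumes nonneg: "\<And>k. r k \<ge> 0" "n \<ge> 0" and b: "b > 0"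
    and doubling: "\<And>k. (r k)\<^sup>2 \<le> r (Suc k) * n" and growth: "\<And>k. r k \<le> K * b ^ 2 ^ k"
  shows "r 0 \<le> b * n"
proof (cases "n = 0")
  case True then show ?thesis using doubling[of 0] nonneg(1)[of 0] by simp
next
  case False
  then have n: "n > 0" using nonneg(2) by simp
  have iterate: "r 0 ^ 2 ^ k * n \<le> r k * n ^ 2 ^ k" for k
  proof (induction k)
    case (Suc k)
    have "r 0 ^ 2 ^ Suc k * n * n = (r 0 ^ 2 ^ k * n)\<^sup>2"
      by (simp add: power2_eq_square mult_2 power_add mult_ac)
    also have "\<dots> \<le> (r k * n ^ 2 ^ k)\<^sup>2" using Suc nonneg by (intro power_mono) auto
    also have "\<dots> = (r k)\<^sup>2 * n ^ 2 ^ Suc k" by (simp add: power2_eq_square mult_2 power_add mult_ac)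
    also have "\<dots> \<le> (r (Suc k) * n) * n ^ 2 ^ Suc k" using nonneg by (intro mult_right_mono doubling) auto
    finally show ?case using n by (simp add: mult_ac)
  qed simp
  have bounded: "(r 0 / (b * n)) ^ 2 ^ k \<le> K / n" for k
  proof -
    have "r 0 ^ 2 ^ k * n \<le> K * (b * n) ^ 2 ^ k"
      using order_trans[OF iterate mult_right_mono[OF growth]] n
      by (simp add: power_mult_distrib mult_ac)
    then show ?thesis using n b by (simp add: power_divide field_simps)
  qed
  have "r 0 / (b * n) \<le> 1"
  proof (rule ccontr)
    assume "\<not> r 0 / (b * n) \<le> 1"
    then have gt: "r 0 / (b * n) > 1" by simp
    then obtain m where "K / n < (r 0 / (b * n)) ^ m" using real_arch_pow by blast
    also have "\<dots> \<le> (r 0 / (b * n)) ^ 2 ^ m"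
      using gt by (intro power_increasing less_imp_le less_exp) auto
    finally show False using bounded[of m] by simp
  qed
  then show ?thesis using n b by (simp add: field_simps)
qed

text \<open>An element \<open>v\<close> stands for \<open>B \<mapsto> \<Sum> A\<^sub>i B \<xi>\<^sub>i\<close>; with \<open>B\<close> as an argument, \<open>v E\<close> and \<open>v C\<close>
  share the coefficients \<open>A\<^sub>i\<close> and \<open>\<xi>\<^sub>i\<close>.\<close>
inductive_set operator_sums :: "('a::chilbert \<Rightarrow> 'a) set \<Rightarrow> (('a \<Rightarrow> 'a) \<Rightarrow> 'a) set"
  for N :: "('a \<Rightarrow> 'a) set" where
  monomial: "A \<in> N \<Longrightarrow> (\<lambda>B. A (B \<xi>)) \<in> operator_sums N"
| add: "v \<in> operator_sums N \<Longrightarrow> w \<in> operator_sums N \<Longrightarrow> (\<lambda>B. v B + w B) \<in> operator_sums N"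
| scaleC: "v \<in> operator_sums N \<Longrightarrow> (\<lambda>B. scaleC c (v B)) \<in> operator_sums N"

lemma operator_sums_bounded:
  assumes N: "\<And>A. A \<in> N \<Longrightarrow> bop UNIV A" and v: "v \<in> operator_sums N"
  shows "\<exists>K. \<forall>B \<beta>. (\<forall>x. norm (B x) \<le> \<beta> * norm x) \<longrightarrow> norm (v B) \<le> K * \<beta>"
  using v
proof induction
  case (monomial A \<xi>)
  obtain a where a: "a > 0" "\<And>x. norm (A x) \<le> a * norm x" using bop_bound[OF N[OF monomial]] by auto
  have "norm (A (B \<xi>)) \<le> a * norm \<xi> * \<beta>" if "\<forall>x. norm (B x) \<le> \<beta> * norm x" for B \<beta>
    using order_trans[OF a(2)[of "B \<xi>"] mult_left_mono[OF spec[OF that, of \<xi>], of a]] a(1)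
    by (simp add: mult_ac)
  then show ?case by blast
next
  case (add v w)
  then obtain K L where "\<forall>B \<beta>. (\<forall>x. norm (B x) \<le> \<beta> * norm x) \<longrightarrow> norm (v B) \<le> K * \<beta>"
    "\<forall>B \<beta>. (\<forall>x. norm (B x) \<le> \<beta> * norm x) \<longrightarrow> norm (w B) \<le> L * \<beta>" by blast
  then have "\<forall>B \<beta>. (\<forall>x. norm (B x) \<le> \<beta> * norm x) \<longrightarrow> norm (v B + w B) \<le> (K + L) * \<beta>"
    by (simp add: distrib_right norm_triangle_mono)
  then show ?case by blast
next
  case (scaleC v c)
  then obtain K where "\<forall>B \<beta>. (\<forall>x. norm (B x) \<le> \<beta> * norm x) \<longrightarrow> norm (v B) \<le> K * \<beta>" by blast
  then have "\<forall>B \<beta>. (\<forall>x. norm (B x) \<le> \<beta> * norm x) \<longrightarrow> norm (scaleC c (v B)) \<le> cmod c * K * \<beta>"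
    by (simp add: norm_scaleC mult.assoc mult_left_mono)
  then show ?case by blast
qed

text \<open>An operator on the range of \<open>E\<close> is identified with its extension by zero, hence \<open>B E = B\<close>.\<close>
definition reduced_commutant :: "('a::chilbert \<Rightarrow> 'a) set \<Rightarrow> ('a \<Rightarrow> 'a) \<Rightarrow> ('a \<Rightarrow> 'a) set" where
  "reduced_commutant N E = {B \<in> bcomm UNIV ((\<lambda>A x. E (A (E x))) ` N). \<forall>x. B (E x) = B x}"

locale reduced_algebra =
  fixes N :: "('a::chilbert \<Rightarrow> 'a) set" and E :: "'a \<Rightarrow> 'a"
  assumes N_star: "star_closed N" and N_id: "(\<lambda>x. x) \<in> N"
    and N_comp: "A \<in> N \<Longrightarrow> B \<in> N \<Longrightarrow> (\<lambda>x. A (B x)) \<in> N"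
    and E: "is_projection UNIV E"
begin

lemma reduced_commutant_bop: "B \<in> reduced_commutant N E \<Longrightarrow> bop UNIV B"
  and reduced_commutant_E_right: "B \<in> reduced_commutant N E \<Longrightarrow> B (E x) = B x"
  by (simp_all add: reduced_commutant_def bcomm_def)

lemma reduced_commutant_commute:
  "B \<in> reduced_commutant N E \<Longrightarrow> A \<in> N \<Longrightarrow> B (E (A (E x))) = E (A (E (B x)))"
  using bcomm_commute[of B UNIV "(\<lambda>A x. E (A (E x))) ` N" "\<lambda>x. E (A (E x))" x]
  by (simp add: reduced_commutant_def)

lemma reduced_commutant_E_left: "B \<in> reduced_commutant N E \<Longrightarrow> E (B x) = B x"
  using reduced_commutant_commute[OF _ N_id, of B x]
  by (simp add: reduced_commutant_E_right is_projection_idem[OF E])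

lemma reduced_commutant_comp:
  assumes "B \<in> reduced_commutant N E" "C \<in> reduced_commutant N E"
  shows "(\<lambda>x. B (C x)) \<in> reduced_commutant N E"
  using assms by (simp add: reduced_commutant_def bcomm_comp)

lemma star_closed_reduction: "star_closed ((\<lambda>A x. E (A (E x))) ` N)"
proof -
  note bop_E = is_projection_bop[OF E]
  have "bop UNIV (\<lambda>x. E (A (E x)))" "adj (\<lambda>x. E (A (E x))) = (\<lambda>x. E (adj A (E x)))" if "A \<in> N" for A
  proof -
    have bop_A: "bop UNIV A" by (rule star_closed_bop[OF N_star that])
    show "bop UNIV (\<lambda>x. E (A (E x)))" by (intro bop_UNIV_comp[OF bop_E] bop_UNIV_comp[OF bop_A] bop_E)
    then show "adj (\<lambda>x. E (A (E x))) = (\<lambda>x. E (adj A (E x)))"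
      by (rule adj_eqI) (simp add: cinner_is_projection[OF E] cinner_adj_right[OF bop_A])
  qed
  then show ?thesis by (auto simp: star_closed_def star_closed_adj[OF N_star])
qed

lemma reduced_commutant_adj:
  assumes B: "B \<in> reduced_commutant N E"
  shows "adj B \<in> reduced_commutant N E"
proof -
  have "adj B \<in> bcomm UNIV ((\<lambda>A x. E (A (E x))) ` N)"
    using B star_closed_adj[OF star_closed_bcomm[OF star_closed_reduction]]
    by (simp add: reduced_commutant_def)
  moreover have "adj B (E x) = adj B x" for x
    by (rule cinner_eqI)
      (simp add: cinner_adj_left[OF reduced_commutant_bop[OF B]] cinner_is_projection[OF E]
        reduced_commutant_E_left[OF B])
  ultimately show ?thesis by (simp add: reduced_commutant_def)
qed

lemma cinner_monomial_transfer:
  assumes B: "B \<in> reduced_commutant N E" and C: "C \<in> reduced_commutant N E"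
    and A: "A \<in> N" and A': "A' \<in> N"
  shows "cinner (A (B \<xi>)) (A' (C \<eta>)) = cinner (A (adj C (B \<xi>))) (A' (E \<eta>))"
proof -
  let ?A = "\<lambda>x. adj A' (A x)"
  have AA: "?A \<in> N" by (rule N_comp[OF star_closed_adj[OF N_star A'] A])
  note cinner_A' = cinner_adj_left[OF star_closed_bop[OF N_star A']]
  have "cinner (A (B \<xi>)) (A' (C \<eta>)) = cinner (?A (E (B \<xi>))) (E (C \<eta>))"
    by (simp add: cinner_A' reduced_commutant_E_left B C)
  also have "\<dots> = cinner (adj C (E (?A (E (B \<xi>))))) \<eta>"
    by (simp add: cinner_is_projection[OF E] cinner_adj_left reduced_commutant_bop C
        reduced_commutant_E_left)
  also have "\<dots> = cinner (E (?A (adj C (B \<xi>)))) \<eta>"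
    using reduced_commutant_commute[OF reduced_commutant_adj[OF C] AA, of "B \<xi>"]
    by (simp add: reduced_commutant_E_left B reduced_commutant_adj C)
  also have "\<dots> = cinner (A (adj C (B \<xi>))) (A' (E \<eta>))" by (simp add: cinner_is_projection[OF E] cinner_A')
  finally show ?thesis .
qed

lemma cinner_operator_sums_transfer:
  assumes v: "v \<in> operator_sums N" and w: "w \<in> operator_sums N"
    and B: "B \<in> reduced_commutant N E" and C: "C \<in> reduced_commutant N E"
  shows "cinner (v B) (w C) = cinner (v (\<lambda>x. adj C (B x))) (w E)"
  using v
proof induction
  case (monomial A \<xi>)
  show ?case
    using w
  proof induction
    case (monomial A' \<eta>)
    then show ?case by (rule cinner_monomial_transfer[OF B C \<open>A \<in> N\<close>])
  qed (simp_all add: cinner_add_right cinner_scaleC_right)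
qed (simp_all add: cinner_add_left cinner_scaleC_left)

lemma norm_operator_sums_sq_le:
  assumes v: "v \<in> operator_sums N" and B: "B \<in> reduced_commutant N E"
  shows "(norm (v B))\<^sup>2 \<le> norm (v (\<lambda>x. adj B (B x))) * norm (v E)"
  unfolding norm_sq_eq_cmod_cinner cinner_operator_sums_transfer[OF v v B B]
  by (rule cinner_Cauchy_Schwarz)

lemma funpow_in_reduced_commutant:
  assumes "B \<in> reduced_commutant N E" "k > 0"
  shows "B ^^ k \<in> reduced_commutant N E"
  using assms(2)
proof (induction k rule: nat_induct_non_zero)
  case (Suc k)
  then show ?case using reduced_commutant_comp[OF assms(1)] by (simp add: o_def)
qed (simp add: assms(1))

text \<open>Iterating \<open>norm_operator_sums_sq_le\<close> along the powers of \<open>B\<close> makes the square root of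
  a positive operator, and hence the spectral theorem, unnecessary.\<close>
lemma norm_operator_sums_le_symmetric:
  assumes v: "v \<in> operator_sums N" and B: "B \<in> reduced_commutant N E"
    and symmetric: "\<And>x y. cinner (B x) y = cinner x (B y)"
    and b: "b > 0" "\<And>x. norm (B x) \<le> b * norm x"
  shows "norm (v B) \<le> b * norm (v E)"
proof -
  obtain K where K: "\<And>C \<beta>. (\<forall>x. norm (C x) \<le> \<beta> * norm x) \<Longrightarrow> norm (v C) \<le> K * \<beta>"
    using operator_sums_bounded[OF star_closed_bop[OF N_star] v] by blast
  have symmetric_pow: "cinner ((B ^^ k) x) y = cinner x ((B ^^ k) y)" for k x y
    by (induction k arbitrary: x y) (simp_all add: symmetric funpow_swap1)
  have norm_pow: "norm ((B ^^ k) x) \<le> b ^ k * norm x" for k x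
  proof (induction k)
    case (Suc k)
    show ?case using order_trans[OF b(2) mult_left_mono[OF Suc]] b(1) by (simp add: mult.assoc)
  qed simp
  have "norm (v (B ^^ 2 ^ 0)) \<le> b * norm (v E)"
  proof (rule doubling_sequence_le[of "\<lambda>k. norm (v (B ^^ 2 ^ k))"])
    fix k
    let ?Q = "B ^^ 2 ^ k"
    have Q: "?Q \<in> reduced_commutant N E" by (rule funpow_in_reduced_commutant[OF B]) simp
    have "adj ?Q = ?Q" by (rule adj_eqI[OF reduced_commutant_bop[OF Q] symmetric_pow])
    moreover have "B ^^ 2 ^ Suc k = (\<lambda>x. ?Q (?Q x))" by (simp add: mult_2 funpow_add o_def)
    ultimately show "(norm (v ?Q))\<^sup>2 \<le> norm (v (B ^^ 2 ^ Suc k)) * norm (v E)"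
      using norm_operator_sums_sq_le[OF v Q] by simp
    show "norm (v ?Q) \<le> K * b ^ 2 ^ k" by (rule K) (simp add: norm_pow)
  qed (simp_all add: b)
  then show ?thesis by simp
qed

lemma norm_operator_sums_le:
  assumes v: "v \<in> operator_sums N" and C: "C \<in> reduced_commutant N E"
    and c: "c > 0" "\<And>x. norm (C x) \<le> c * norm x"
  shows "norm (v C) \<le> c * norm (v E)"
proof -
  note bop_C = reduced_commutant_bop[OF C]
  let ?B = "\<lambda>x. adj C (C x)"
  have "norm (v ?B) \<le> c\<^sup>2 * norm (v E)"
  proof (rule norm_operator_sums_le_symmetric[OF v])
    show "?B \<in> reduced_commutant N E" by (rule reduced_commutant_comp[OF reduced_commutant_adj[OF C] C])
    show "cinner (?B x) y = cinner x (?B y)" for x y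
      by (simp add: cinner_adj_left[OF bop_C] cinner_adj_right[OF bop_C])
    show "norm (?B x) \<le> c\<^sup>2 * norm x" for x
      using order_trans[OF norm_adj_le[OF bop_C c(2)] mult_left_mono[OF c(2)]] c(1)
      by (simp add: power2_eq_square mult.assoc)
  qed (use c(1) in simp)
  then have "norm (v ?B) * norm (v E) \<le> (c\<^sup>2 * norm (v E)) * norm (v E)" by (rule mult_right_mono) simp
  then have "(norm (v C))\<^sup>2 \<le> (c * norm (v E))\<^sup>2"
    using norm_operator_sums_sq_le[OF v C] by (simp add: power2_eq_square mult_ac)
  then show ?thesis by (rule power2_le_imp_le) (use c(1) in simp)
qed

lemma operator_sums_comp:
  assumes A: "A \<in> N" and v: "v \<in> operator_sums N"
  shows "(\<lambda>B. A (v B)) \<in> operator_sums N"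
  using v
proof induction
  case (monomial A' \<xi>)
  then show ?case using operator_sums.monomial[OF N_comp[OF A]] by simp
qed (simp_all add: bop_add[OF star_closed_bop[OF N_star A]] bop_scaleC[OF star_closed_bop[OF N_star A]]
      operator_sums.intros)

lemma csubspace_operator_sums_pairs: "csubspace ((\<lambda>v. (v E, v C)) ` operator_sums N)"
  unfolding csubspace_def
proof (intro conjI ballI allI)
  let ?G = "(\<lambda>v. (v E, v C)) ` operator_sums N"
  show "x + y \<in> ?G" if "x \<in> ?G" "y \<in> ?G" for x y
    using that by (auto intro!: image_eqI[OF _ operator_sums.add])
  show scale: "scaleC k x \<in> ?G" if "x \<in> ?G" for k x
    using that by (auto simp: scaleC_prod_def intro!: image_eqI[OF _ operator_sums.scaleC])
  have "(\<lambda>B. B 0) \<in> operator_sums N" by (rule operator_sums.monomial[OF N_id])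
  then show "0 \<in> ?G" using scale[of _ 0] by auto
qed

lemma reduced_commutant_extension:
  assumes C: "C \<in> reduced_commutant N E"
  shows "\<exists>T\<in>bcomm UNIV N. \<forall>x. T (E x) = C x"
proof -
  let ?G = "(\<lambda>v. (v E, v C)) ` operator_sums N"
  obtain c where c: "c > 0" "\<And>x. norm (C x) \<le> c * norm x"
    using bop_bound[OF reduced_commutant_bop[OF C]] by auto
  interpret bounded_graph "closure ?G" c
    by (rule bounded_graph_closure)
      (use csubspace_operator_sums_pairs norm_operator_sums_le[OF _ C c] c(1) in auto)
  have invariant: "map_prod A A ` closure ?G \<subseteq> closure ?G" if A: "A \<in> N" for A
  proof (rule closure_invariant)
    show "bounded_linear (map_prod A A)"
      by (intro bop_UNIV_bounded_linear bop_map_prod star_closed_bop[OF N_star A])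
    show "map_prod A A ` ?G \<subseteq> ?G" using operator_sums_comp[OF A] by auto
  qed
  have "graph_op (A x) = A (graph_op x)" if A: "A \<in> N" for A x
    by (intro graph_op_commute star_closed_bop[OF N_star A] invariant star_closed_adj[OF N_star A] A)
  then have "graph_op \<in> bcomm UNIV N" by (simp add: bcomm_def bop_graph_op)
  moreover have "graph_op (E x) = C x" for x
  proof -
    have "(\<lambda>B. B x) \<in> operator_sums N" by (rule operator_sums.monomial[OF N_id])
    then have "(E x, C x) \<in> ?G" by (rule rev_image_eqI) simp
    then show ?thesis by (rule graph_op_eq[OF subsetD[OF closure_subset]])
  qed
  ultimately show ?thesis by blast
qed

end

section \<open>O*-algebras\<close>

lemma Ldag_outside: "X \<in> Ldag D \<Longrightarrow> x \<notin> D \<Longrightarrow> X x = 0"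
  and Ldag_linear: "X \<in> Ldag D \<Longrightarrow> clinear_on D X"
  and Ldag_in: "X \<in> Ldag D \<Longrightarrow> x \<in> D \<Longrightarrow> X x \<in> D"
  by (auto simp: Ldag_def ext_on_def)

lemma LdagI:
  assumes "ext_on D X" "clinear_on D X" "\<And>\<xi>. \<xi> \<in> D \<Longrightarrow> X \<xi> \<in> D"
    "\<And>\<eta>. \<eta> \<in> D \<Longrightarrow> Y \<eta> \<in> D" "\<And>\<xi> \<eta>. \<xi> \<in> D \<Longrightarrow> \<eta> \<in> D \<Longrightarrow> cinner (X \<xi>) \<eta> = cinner \<xi> (Y \<eta>)"
  shows "X \<in> Ldag D"
  using assms unfolding Ldag_def by blast

lemma dagger_eqI:
  assumes D: "csubspace D" and Y: "ext_on D Y" "\<And>\<eta>. \<eta> \<in> D \<Longrightarrow> Y \<eta> \<in> D"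
    "\<And>\<xi> \<eta>. \<xi> \<in> D \<Longrightarrow> \<eta> \<in> D \<Longrightarrow> cinner (X \<xi>) \<eta> = cinner \<xi> (Y \<eta>)"
  shows "dagger D X = Y"
proof
  fix \<eta>
  show "dagger D X \<eta> = Y \<eta>"
  proof (cases "\<eta> \<in> D")
    case True
    have "(THE \<zeta>. \<zeta> \<in> D \<and> (\<forall>\<xi>\<in>D. cinner (X \<xi>) \<eta> = cinner \<xi> \<zeta>)) = Y \<eta>"
    proof (rule the_equality)
      show "Y \<eta> \<in> D \<and> (\<forall>\<xi>\<in>D. cinner (X \<xi>) \<eta> = cinner \<xi> (Y \<eta>))" using Y True by auto
      fix \<zeta> assume \<zeta>: "\<zeta> \<in> D \<and> (\<forall>\<xi>\<in>D. cinner (X \<xi>) \<eta> = cinner \<xi> \<zeta>)"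
      show "\<zeta> = Y \<eta>"
      proof (rule cinner_eq_on_dense)
        show "cinner \<zeta> \<xi> = cinner (Y \<eta>) \<xi>" if "\<xi> \<in> D" for \<xi>
          using \<zeta> Y(3)[OF that True] that by (metis cinner_commute)
        show "\<zeta> - Y \<eta> \<in> closure D"
          using \<zeta> csubspace_diff[OF D _ Y(2)[OF True]] closure_subset by blast
      qed
    qed
    then show ?thesis using True by (simp add: dagger_def)
  qed (use Y(1) in \<open>simp add: dagger_def ext_on_def\<close>)
qed

lemma
  assumes D: "csubspace D" and X: "X \<in> Ldag D"
  shows dagger_in: "\<eta> \<in> D \<Longrightarrow> dagger D X \<eta> \<in> D"
    and cinner_dagger_right: "\<xi> \<in> D \<Longrightarrow> \<eta> \<in> D \<Longrightarrow> cinner (X \<xi>) \<eta> = cinner \<xi> (dagger D X \<eta>)"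
proof -
  have "\<forall>\<eta>\<in>D. \<exists>\<zeta>. \<zeta> \<in> D \<and> (\<forall>\<xi>\<in>D. cinner (X \<xi>) \<eta> = cinner \<xi> \<zeta>)"
    using X unfolding Ldag_def by blast
  from bchoice[OF this] obtain Y
    where Y: "\<forall>\<eta>\<in>D. Y \<eta> \<in> D \<and> (\<forall>\<xi>\<in>D. cinner (X \<xi>) \<eta> = cinner \<xi> (Y \<eta>))" by blast
  have "dagger D X = restr D Y"
    by (rule dagger_eqI[OF D]) (use Y in \<open>auto simp: restr_def ext_on_def\<close>)
  then show "\<eta> \<in> D \<Longrightarrow> dagger D X \<eta> \<in> D"
    "\<xi> \<in> D \<Longrightarrow> \<eta> \<in> D \<Longrightarrow> cinner (X \<xi>) \<eta> = cinner \<xi> (dagger D X \<eta>)"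
    using Y by (auto simp: restr_def)
qed

lemma cinner_dagger_left:
  assumes "csubspace D" "X \<in> Ldag D" "\<xi> \<in> D" "\<eta> \<in> D"
  shows "cinner (dagger D X \<eta>) \<xi> = cinner \<eta> (X \<xi>)"
  using cinner_dagger_right[OF assms] by (metis cinner_commute)

lemma dagger_dagger:
  assumes "csubspace D" "X \<in> Ldag D"
  shows "dagger D (dagger D X) = X"
  by (rule dagger_eqI[OF assms(1)])
    (use assms in \<open>auto simp: ext_on_def Ldag_outside Ldag_in cinner_dagger_left\<close>)

lemma wcomm_bop: "C \<in> wcomm K D M \<Longrightarrow> bop K C"
  and wcomm_cinner: "C \<in> wcomm K D M \<Longrightarrow> X \<in> M \<Longrightarrow> \<xi> \<in> D \<Longrightarrow> \<eta> \<in> D \<Longrightarrow>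
    cinner (C (X \<xi>)) \<eta> = cinner (C \<xi>) (dagger D X \<eta>)"
  by (auto simp: wcomm_def)

lemma wbicomm_c_Ldag: "X \<in> wbicomm_c K D M \<Longrightarrow> X \<in> Ldag D"
  and wbicomm_c_cinner: "X \<in> wbicomm_c K D M \<Longrightarrow> C \<in> wcomm K D M \<Longrightarrow> \<xi> \<in> D \<Longrightarrow> \<eta> \<in> D \<Longrightarrow>
    cinner (C (X \<xi>)) \<eta> = cinner (C \<xi>) (dagger D X \<eta>)"
  by (auto simp: wbicomm_c_def)

lemma
  assumes D: "csubspace D" "closure D = UNIV" and X: "clinear_on D X"
    and bound: "\<And>x. x \<in> D \<Longrightarrow> norm (X x) \<le> b * norm x"
  shows bop_bclos: "bop UNIV (bclos UNIV D X)" and bclos_eq: "\<xi> \<in> D \<Longrightarrow> bclos UNIV D X \<xi> = X \<xi>"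
proof -
  obtain A where A: "bop UNIV A" "\<forall>x\<in>D. A x = X x"
    using bounded_operator_extension[OF D(1) X bound] by blast
  have "bclos UNIV D X = A"
    unfolding bclos_def
  proof (rule the_equality)
    show "B = A" if "bop UNIV B \<and> (\<forall>\<xi>\<in>D. B \<xi> = X \<xi>)" for B
      by (rule bop_eq_on_dense[OF _ A(1) D(2)]) (use that A(2) in auto)
  qed (use A in simp)
  then show "bop UNIV (bclos UNIV D X)" "\<xi> \<in> D \<Longrightarrow> bclos UNIV D X \<xi> = X \<xi>" using A by auto
qed

lemma adj_eq_dagger:
  assumes D: "csubspace D" "closure D = UNIV" and X: "X \<in> Ldag D"
    and A: "bop UNIV A" "\<And>\<xi>. \<xi> \<in> D \<Longrightarrow> A \<xi> = X \<xi>" and \<eta>: "\<eta> \<in> D"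
  shows "adj A \<eta> = dagger D X \<eta>"
proof (rule cinner_eq_on_dense)
  show "cinner (adj A \<eta>) \<xi> = cinner (dagger D X \<eta>) \<xi>" if "\<xi> \<in> D" for \<xi>
    using that A(2) by (simp add: cinner_adj_left[OF A(1)] cinner_dagger_left[OF D(1) X that \<eta>])
  show "adj A \<eta> - dagger D X \<eta> \<in> closure D" using D(2) by simp
qed

lemma tM_cauchy_principal: "\<xi> \<in> D \<Longrightarrow> tM_cauchy M D (principal {\<xi>})"
  by (auto simp: tM_cauchy_def eventually_principal principal_eq_bot_iff principal_prod_principal)

lemma closed_O_limits:
  assumes closed: "closed_O M D" and F: "tM_cauchy M D F" and limit: "((\<lambda>x. x) \<longlongrightarrow> \<xi>) F"
  shows "\<xi> \<in> D" "X \<in> M \<Longrightarrow> (X \<longlongrightarrow> X \<xi>) F"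
proof -
  from closed F obtain \<xi>' where \<xi>': "\<xi>' \<in> D" "((\<lambda>x. x) \<longlongrightarrow> \<xi>') F" "\<forall>X\<in>M. (X \<longlongrightarrow> X \<xi>') F"
    by (auto simp: closed_O_def)
  have "F \<noteq> bot" using F by (simp add: tM_cauchy_def)
  then have "\<xi>' = \<xi>" using tendsto_unique \<xi>'(2) limit by blast
  then show "\<xi> \<in> D" "X \<in> M \<Longrightarrow> (X \<longlongrightarrow> X \<xi>) F" using \<xi>' by auto
qed

lemma Dtilde_closed_O:
  assumes closed: "closed_O M D"
  shows "Dtilde M D = D"
proof
  show "Dtilde M D \<subseteq> D" using closed_O_limits(1)[OF closed] by (auto simp: Dtilde_def)
  show "D \<subseteq> Dtilde M D"
    using tM_cauchy_principal tendsto_principal_singleton[of "\<lambda>x. x"] by (fastforce simp: Dtilde_def)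
qed

lemma closure_op_closed_O:
  assumes closed: "closed_O M D" and X: "X \<in> M" and \<xi>: "\<xi> \<in> D"
  shows "closure_op M D X \<xi> = X \<xi>"
proof -
  have "(THE \<zeta>. \<exists>F. tM_cauchy M D F \<and> ((\<lambda>x. x) \<longlongrightarrow> \<xi>) F \<and> (X \<longlongrightarrow> \<zeta>) F) = X \<xi>"
  proof (rule the_equality)
    show "\<exists>F. tM_cauchy M D F \<and> ((\<lambda>x. x) \<longlongrightarrow> \<xi>) F \<and> (X \<longlongrightarrow> X \<xi>) F"
      using tM_cauchy_principal[OF \<xi>] tendsto_principal_singleton[of X \<xi>]
        tendsto_principal_singleton[of "\<lambda>x. x" \<xi>] by blast
  next
    fix \<zeta> assume "\<exists>F. tM_cauchy M D F \<and> ((\<lambda>x. x) \<longlongrightarrow> \<xi>) F \<and> (X \<longlongrightarrow> \<zeta>) F"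
    then obtain F where F: "tM_cauchy M D F" "((\<lambda>x. x) \<longlongrightarrow> \<xi>) F" "(X \<longlongrightarrow> \<zeta>) F" by blast
    have "F \<noteq> bot" using F(1) by (simp add: tM_cauchy_def)
    then show "\<zeta> = X \<xi>" using tendsto_unique F(3) closed_O_limits(2)[OF closed F(1,2) X] by blast
  qed
  then show ?thesis using \<xi> by (simp add: closure_op_def Dtilde_closed_O[OF closed])
qed

lemma closure_alg_closed_O:
  assumes closed: "closed_O M D" and M: "M \<subseteq> Ldag D"
  shows "closure_alg M D = M"
proof -
  have "closure_op M D X = X" if X: "X \<in> M" for X
  proof
    show "closure_op M D X \<xi> = X \<xi>" for \<xi>
      using closure_op_closed_O[OF closed X] Ldag_outside[of X D \<xi>] M X
      by (cases "\<xi> \<in> D") (auto simp: closure_op_def Dtilde_closed_O[OF closed])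
  qed
  then show ?thesis by (force simp: closure_alg_def)
qed

locale Ostar_algebra =
  fixes D :: "'a::chilbert set" and M :: "('a \<Rightarrow> 'a) set"
  assumes Ostar: "Ostar UNIV D M"
begin

lemma csubspace_D: "csubspace D" and closure_D: "closure D = UNIV"
  using Ostar by (auto simp: Ostar_def dense_in_def)

lemma M_Ldag: "X \<in> M \<Longrightarrow> X \<in> Ldag D"
  and M_add: "X \<in> M \<Longrightarrow> Y \<in> M \<Longrightarrow> (\<lambda>x. X x + Y x) \<in> M"
  and M_scaleC: "X \<in> M \<Longrightarrow> (\<lambda>x. scaleC c (X x)) \<in> M"
  and M_comp: "X \<in> M \<Longrightarrow> Y \<in> M \<Longrightarrow> (\<lambda>x. X (Y x)) \<in> M"
  and M_dagger: "X \<in> M \<Longrightarrow> dagger D X \<in> M"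
  using Ostar by (auto simp: Ostar_def)

lemma star_closed_wcomm: "star_closed (wcomm UNIV D M)"
  unfolding star_closed_def
proof (intro ballI conjI)
  fix C assume C: "C \<in> wcomm UNIV D M"
  show bop_C: "bop UNIV C" using C by (rule wcomm_bop)
  have "cinner (adj C (X \<xi>)) \<eta> = cinner (adj C \<xi>) (dagger D X \<eta>)"
    if X: "X \<in> M" and \<xi>: "\<xi> \<in> D" and \<eta>: "\<eta> \<in> D" for X \<xi> \<eta>
  proof -
    have "cinner (C (dagger D X \<eta>)) \<xi> = cinner (C \<eta>) (X \<xi>)"
      using wcomm_cinner[OF C M_dagger[OF X] \<eta> \<xi>] dagger_dagger[OF csubspace_D M_Ldag[OF X]] by simp
    then show ?thesis unfolding cinner_adj_left[OF bop_C] by (metis cinner_commute)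
  qed
  then show "adj C \<in> wcomm UNIV D M" by (simp add: wcomm_def bop_adj[OF bop_C])
qed

end

locale GWstar_algebra =
  fixes D :: "'a::chilbert set" and M :: "('a \<Rightarrow> 'a) set"
  assumes GWstar: "GWstar UNIV D M"
begin

sublocale Ostar_algebra
  by unfold_locales (use GWstar in \<open>simp add: GWstar_def\<close>)

lemma closed_M: "closed_O M D" and M_eq_wbicomm_c: "M = wbicomm_c UNIV D M"
  using GWstar by (simp_all add: GWstar_def)

lemma wcomm_invariant: "C \<in> wcomm UNIV D M \<Longrightarrow> \<xi> \<in> D \<Longrightarrow> C \<xi> \<in> D"
  using GWstar by (auto simp: GWstar_def)

lemma wcomm_commute:
  assumes C: "C \<in> wcomm UNIV D M" and X: "X \<in> M" and \<xi>: "\<xi> \<in> D"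
  shows "C (X \<xi>) = X (C \<xi>)"
proof (rule cinner_eq_on_dense)
  show "cinner (C (X \<xi>)) \<eta> = cinner (X (C \<xi>)) \<eta>" if \<eta>: "\<eta> \<in> D" for \<eta>
    using wcomm_cinner[OF C X \<xi> \<eta>]
      cinner_dagger_right[OF csubspace_D M_Ldag[OF X] wcomm_invariant[OF C \<xi>] \<eta>] by simp
qed (simp add: closure_D)

lemma wcomm_bicommutant:
  assumes T: "T \<in> bcomm UNIV (bcomm UNIV (wcomm UNIV D M))"
  shows "T \<in> wcomm UNIV D M"
proof -
  have "cinner (T (X \<xi>)) \<eta> = cinner (T \<xi>) (dagger D X \<eta>)"
    if X: "X \<in> M" and \<xi>: "\<xi> \<in> D" and \<eta>: "\<eta> \<in> D" for X \<xi> \<eta>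
  proof -
    let ?graph = "(\<lambda>\<zeta>. (\<zeta>, X \<zeta>)) ` D"
    have "map_prod C C ` closure ?graph \<subseteq> closure ?graph" if C: "C \<in> wcomm UNIV D M" for C
      by (rule closure_invariant)
        (use wcomm_invariant[OF C] wcomm_commute[OF C X] in
          \<open>auto intro: bop_UNIV_bounded_linear bop_map_prod wcomm_bop[OF C]\<close>)
    then have T_invariant: "map_prod T T ` closure ?graph \<subseteq> closure ?graph"
      by (intro bicommutant_invariant_subspace[OF star_closed_wcomm _ closed_closure _ T]
          csubspace_closure csubspace_graph csubspace_D Ldag_linear M_Ldag X)
    have "(\<xi>, X \<xi>) \<in> ?graph" using \<xi> by blast
    then have "(\<xi>, X \<xi>) \<in> closure ?graph" by (rule subsetD[OF closure_subset])
    then have "map_prod T T (\<xi>, X \<xi>) \<in> closure ?graph" by (rule subsetD[OF T_invariant imageI])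
    moreover have "closure ?graph \<subseteq> {z. cinner (snd z) \<eta> = cinner (fst z) (dagger D X \<eta>)}"
      by (rule closure_minimal)
        (use cinner_dagger_right[OF csubspace_D M_Ldag[OF X] _ \<eta>] in
          \<open>auto intro!: closed_Collect_eq cinner.continuous_on continuous_intros\<close>)
    ultimately show ?thesis by auto
  qed
  then show ?thesis using bcomm_bop[OF T] by (simp add: wcomm_def)
qed

end

section \<open>Reduction of a GW*-algebra by a projection\<close>

locale reduced_GWstar = GWstar_algebra D M
  for D :: "'a::chilbert set" and M :: "('a \<Rightarrow> 'a) set" +
  fixes E :: "'a \<Rightarrow> 'a"
  assumes projection_E: "is_projection UNIV E" and E_in_M: "restr D E \<in> M"
begin

lemmas bop_E = is_projection_bop[OF projection_E]
  and E_idem = is_projection_idem[OF projection_E]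
  and cinner_E = cinner_is_projection[OF projection_E]

lemma E_fixes: "x \<in> range E \<Longrightarrow> E x = x"
  using E_idem by auto

lemma E_in: "x \<in> D \<Longrightarrow> E x \<in> D"
  using Ldag_in[OF M_Ldag[OF E_in_M]] by (auto simp: restr_def)

lemma image_E_iff: "x \<in> E ` D \<longleftrightarrow> x \<in> D \<and> E x = x"
  using E_in E_idem by (auto intro: rev_image_eqI)

lemma csubspace_image_E: "csubspace (E ` D)"
proof -
  have "E ` D = {x \<in> D. E x = x}" using image_E_iff by blast
  then show ?thesis
    using csubspace_0[OF csubspace_D] csubspace_add[OF csubspace_D] csubspace_scaleC[OF csubspace_D]
    by (simp add: csubspace_def bop_UNIV_zero[OF bop_E] bop_add[OF bop_E] bop_scaleC[OF bop_E])
qed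

lemma csubspace_range_E: "csubspace (range E)"
  using hilbert_sub_range_projection[OF projection_E] by (simp add: hilbert_sub_def)

lemma dense_in_image_E: "dense_in (E ` D) (range E)"
  using closure_bounded_linear_image_subset[OF bop_UNIV_bounded_linear[OF bop_E], of D]
  by (auto simp: dense_in_def closure_D)

lemma range_E_eqI:
  assumes "x \<in> range E" "y \<in> range E" "\<And>s. s \<in> E ` D \<Longrightarrow> cinner x s = cinner y s"
  shows "x = y"
  by (rule cinner_eq_on_dense[OF assms(3)])
    (use csubspace_diff[OF csubspace_range_E assms(1,2)] dense_in_image_E in \<open>auto simp: dense_in_def\<close>)

definition compression :: "('a \<Rightarrow> 'a) \<Rightarrow> 'a \<Rightarrow> 'a" where
  "compression X = restr (E ` D) (\<lambda>x. E (X x))"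

lemma compression_apply: "x \<in> E ` D \<Longrightarrow> compression X x = E (X x)"
  and compression_outside: "x \<notin> E ` D \<Longrightarrow> compression X x = 0"
  by (simp_all add: compression_def restr_def)

lemma ME_eq_compressions: "ME D E M = compression ` M"
  by (simp add: ME_def compression_def)

lemma compression_in: "X \<in> M \<Longrightarrow> x \<in> E ` D \<Longrightarrow> compression X x \<in> E ` D"
  using Ldag_in[OF M_Ldag] by (simp add: compression_apply image_E_iff E_in E_idem)

lemma cinner_compression:
  assumes X: "X \<in> M" and \<xi>: "\<xi> \<in> E ` D" and \<eta>: "\<eta> \<in> E ` D"
  shows "cinner (compression X \<xi>) \<eta> = cinner \<xi> (compression (dagger D X) \<eta>)"
proof -
  have "cinner (compression X \<xi>) \<eta> = cinner (X \<xi>) \<eta>"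
    using \<xi> \<eta> by (simp add: compression_apply cinner_E image_E_iff)
  also have "\<dots> = cinner (E \<xi>) (dagger D X \<eta>)"
    using \<xi> \<eta> cinner_dagger_right[OF csubspace_D M_Ldag[OF X]] by (simp add: image_E_iff)
  also have "\<dots> = cinner \<xi> (compression (dagger D X) \<eta>)" using \<eta> by (simp add: compression_apply cinner_E)
  finally show ?thesis .
qed

lemma dagger_compression:
  assumes X: "X \<in> M"
  shows "dagger (E ` D) (compression X) = compression (dagger D X)"
  by (rule dagger_eqI[OF csubspace_image_E])
    (use compression_in[OF M_dagger[OF X]] cinner_compression[OF X] in
      \<open>auto simp: ext_on_def compression_outside\<close>)

lemma compression_Ldag:
  assumes X: "X \<in> M"
  shows "compression X \<in> Ldag (E ` D)"
proof (rule LdagI)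
  have linear: "clinear_on D X" by (rule Ldag_linear[OF M_Ldag[OF X]])
  have "clinear_on (E ` D) (\<lambda>x. E (X x))"
    using linear by (simp add: clinear_on_def image_E_iff bop_add[OF bop_E] bop_scaleC[OF bop_E])
  then show "clinear_on (E ` D) (compression X)"
    by (simp add: clinear_on_def compression_apply csubspace_add csubspace_scaleC csubspace_image_E)
qed (use compression_in[OF X] compression_in[OF M_dagger[OF X]] cinner_compression[OF X] in
    \<open>auto simp: ext_on_def compression_outside\<close>)

lemma compression_comp:
  assumes X: "X \<in> M" and Y: "Y \<in> M"
  shows "(\<lambda>x. compression X (compression Y x)) = compression (\<lambda>x. X (restr D E (Y x)))"
proof
  fix x
  show "compression X (compression Y x) = compression (\<lambda>x. X (restr D E (Y x))) x"
  proof (cases "x \<in> E ` D")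
    case True
    then have "Y x \<in> D" using Ldag_in[OF M_Ldag[OF Y]] by (simp add: image_E_iff)
    then show ?thesis using compression_in[OF Y True] True by (simp add: compression_apply restr_def)
  next
    case False
    then show ?thesis
      using clinear_on_0[OF csubspace_image_E Ldag_linear[OF compression_Ldag[OF X]]]
      by (simp add: compression_outside)
  qed
qed

lemma Ostar_ME: "Ostar (range E) (E ` D) (ME D E M)"
  unfolding Ostar_def ME_eq_compressions
proof (intro conjI ballI allI)
  show "hilbert_sub (range E)" "csubspace (E ` D)" "dense_in (E ` D) (range E)"
    by (rule hilbert_sub_range_projection[OF projection_E] csubspace_image_E dense_in_image_E)+
  show "compression ` M \<subseteq> Ldag (E ` D)" using compression_Ldag by auto
  show "compression ` M \<noteq> {}" using E_in_M by auto
next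
  fix X' Y' assume "X' \<in> compression ` M" "Y' \<in> compression ` M"
  then obtain X Y where X: "X \<in> M" "X' = compression X" and Y: "Y \<in> M" "Y' = compression Y" by auto
  have "(\<lambda>x. X' x + Y' x) = compression (\<lambda>x. X x + Y x)"
    by (auto simp: X Y compression_def restr_def bop_add[OF bop_E])
  then show "(\<lambda>x. X' x + Y' x) \<in> compression ` M" using M_add[OF X(1) Y(1)] by simp
  show "(\<lambda>x. X' (Y' x)) \<in> compression ` M"
    using compression_comp[OF X(1) Y(1)] M_comp[OF X(1) M_comp[OF E_in_M Y(1)]] by (simp add: X Y)
next
  fix c X' assume "X' \<in> compression ` M"
  then obtain X where X: "X \<in> M" "X' = compression X" by auto
  have "(\<lambda>x. scaleC c (X' x)) = compression (\<lambda>x. scaleC c (X x))"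
    by (auto simp: X compression_def restr_def bop_scaleC[OF bop_E])
  then show "(\<lambda>x. scaleC c (X' x)) \<in> compression ` M" using M_scaleC[OF X(1)] by simp
  show "dagger (E ` D) X' \<in> compression ` M" using X dagger_compression M_dagger by simp
qed

subsection \<open>The reduced algebra is closed\<close>

lemma norm_sq_le_compression:
  assumes X: "X \<in> M" and x: "x \<in> E ` D"
  shows "(norm (X x))\<^sup>2 \<le> norm (compression (\<lambda>x. dagger D X (X x)) x) * norm x"
proof -
  have xD: "x \<in> D" "X x \<in> D" using x Ldag_in[OF M_Ldag[OF X]] by (simp_all add: image_E_iff)
  have "cinner (X x) (X x) = cinner (dagger D X (X x)) x"
    using cinner_dagger_left[OF csubspace_D M_Ldag[OF X] xD] by simp
  also have "\<dots> = cinner (compression (\<lambda>x. dagger D X (X x)) x) x"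
    using x by (simp add: compression_apply cinner_E image_E_iff)
  finally show ?thesis unfolding norm_sq_eq_cmod_cinner by (simp only: cinner_Cauchy_Schwarz)
qed

lemma tM_cauchy_compression_imp:
  assumes F: "tM_cauchy (ME D E M) (E ` D) F"
  shows "tM_cauchy M D F"
  unfolding tM_cauchy_def
proof (intro conjI ballI allI impI)
  have F_ED: "eventually (\<lambda>x. x \<in> E ` D) F"
    and F_norm: "\<And>e. e > 0 \<Longrightarrow> eventually (\<lambda>(x, y). norm (x - y) < e) (F \<times>\<^sub>F F)"
    and F_compression: "\<And>X e. X \<in> M \<Longrightarrow> e > 0 \<Longrightarrow>
      eventually (\<lambda>(x, y). norm (compression X x - compression X y) < e) (F \<times>\<^sub>F F)"
    using F by (auto simp: tM_cauchy_def ME_eq_compressions)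
  show "F \<noteq> bot" using F by (simp add: tM_cauchy_def)
  show "eventually (\<lambda>x. x \<in> D) F" using F_ED by (rule eventually_mono) (simp add: image_E_iff)
  show "eventually (\<lambda>(x, y). norm (x - y) < e) (F \<times>\<^sub>F F)" if "e > 0" for e using F_norm[OF that] .
  fix X and e :: real assume X: "X \<in> M" and e: "e > 0"
  let ?Y = "\<lambda>x. dagger D X (X x)"
  have Y: "?Y \<in> M" by (rule M_comp[OF M_dagger[OF X] X])
  have "eventually (\<lambda>(x, y). norm (compression ?Y x - compression ?Y y) < e\<^sup>2) (F \<times>\<^sub>F F)"
    using F_compression[OF Y] e by simp
  moreover have "eventually (\<lambda>(x, y). norm (x - y) < 1) (F \<times>\<^sub>F F)" using F_norm by simp
  moreover have "eventually (\<lambda>(x, y). x \<in> E ` D \<and> y \<in> E ` D) (F \<times>\<^sub>F F)"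
    using F_ED eventually_prod_filter by fastforce
  ultimately show "eventually (\<lambda>(x, y). norm (X x - X y) < e) (F \<times>\<^sub>F F)"
  proof eventually_elim
    case (elim p)
    obtain x y where p: "p = (x, y)" by force
    have xy: "x \<in> E ` D" "y \<in> E ` D" "norm (x - y) < 1"
      and close: "norm (compression ?Y x - compression ?Y y) < e\<^sup>2" using elim p by auto
    have "(norm (X (x - y)))\<^sup>2 \<le> norm (compression ?Y (x - y)) * norm (x - y)"
      by (intro norm_sq_le_compression X csubspace_diff csubspace_image_E xy)
    also have "\<dots> \<le> norm (compression ?Y (x - y))" using xy(3) by (simp add: mult_left_le)
    also have "\<dots> < e\<^sup>2"
      using close clinear_on_diff[OF csubspace_image_E Ldag_linear[OF compression_Ldag[OF Y]] xy(1,2)]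
      by simp
    finally have "norm (X (x - y)) < e" using e by (simp add: power_less_imp_less_base)
    then show ?case
      using p xy clinear_on_diff[OF csubspace_D Ldag_linear[OF M_Ldag[OF X]]] by (simp add: image_E_iff)
  qed
qed

lemma closed_ME: "closed_O (ME D E M) (E ` D)"
  unfolding closed_O_def
proof (intro allI impI)
  fix F assume F: "tM_cauchy (ME D E M) (E ` D) F"
  then have F_bot: "F \<noteq> bot" and F_ED: "eventually (\<lambda>x. x \<in> E ` D) F" by (simp_all add: tM_cauchy_def)
  obtain \<xi> where \<xi>: "\<xi> \<in> D" "((\<lambda>x. x) \<longlongrightarrow> \<xi>) F" "\<And>X. X \<in> M \<Longrightarrow> (X \<longlongrightarrow> X \<xi>) F"
    using closed_M tM_cauchy_compression_imp[OF F] by (auto simp: closed_O_def)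
  have "((\<lambda>x. x) \<longlongrightarrow> E \<xi>) F"
    by (rule Lim_transform_eventually[OF bop_UNIV_tendsto[OF bop_E \<xi>(2)]])
      (rule eventually_mono[OF F_ED], simp add: image_E_iff)
  then have "E \<xi> = \<xi>" using tendsto_unique[OF F_bot] \<xi>(2) by blast
  then have \<xi>_ED: "\<xi> \<in> E ` D" using \<xi>(1) by (simp add: image_E_iff)
  have "(compression X \<longlongrightarrow> compression X \<xi>) F" if X: "X \<in> M" for X
    unfolding compression_apply[OF \<xi>_ED]
    by (rule Lim_transform_eventually[OF bop_UNIV_tendsto[OF bop_E \<xi>(3)[OF X]]])
      (rule eventually_mono[OF F_ED], simp add: compression_apply)
  then show "\<exists>\<xi>\<in>E ` D. ((\<lambda>x. x) \<longlongrightarrow> \<xi>) F \<and> (\<forall>X\<in>ME D E M. (X \<longlongrightarrow> X \<xi>) F)"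
    using \<xi>(2) \<xi>_ED by (auto simp: ME_eq_compressions)
qed

subsection \<open>The weak bicommutant of the reduced algebra\<close>

lemma wcomm_commute_E:
  assumes C: "C \<in> wcomm UNIV D M"
  shows "C (E x) = E (C x)"
proof -
  note bop_C = wcomm_bop[OF C]
  have "(\<lambda>x. C (E x)) = (\<lambda>x. E (C x))"
  proof (rule bop_eq_on_dense[OF bop_UNIV_comp[OF bop_C bop_E] bop_UNIV_comp[OF bop_E bop_C] closure_D])
    show "C (E \<xi>) = E (C \<xi>)" if "\<xi> \<in> D" for \<xi>
      using wcomm_commute[OF C E_in_M that] wcomm_invariant[OF C that] that by (simp add: restr_def)
  qed
  then show ?thesis by (rule fun_cong)
qed

lemma restr_in_wcomm_ME:
  assumes C: "C \<in> wcomm UNIV D M"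
  shows "restr (range E) C \<in> wcomm (range E) (E ` D) (ME D E M)"
proof -
  note bop_C = wcomm_bop[OF C]
  let ?C = "restr (range E) C"
  have C_apply: "?C x = C x" if "x \<in> E ` D" for x using that by (auto simp: restr_def)
  have "C ` range E \<subseteq> range E" by (auto simp: wcomm_commute_E[OF C])
  then have "bop (range E) ?C" by (rule bop_restr[OF csubspace_range_E bop_C])
  moreover have "cinner (?C (compression X \<xi>)) \<eta> = cinner (?C \<xi>) (dagger (E ` D) (compression X) \<eta>)"
    if X: "X \<in> M" and \<xi>: "\<xi> \<in> E ` D" and \<eta>: "\<eta> \<in> E ` D" for X \<xi> \<eta>
  proof -
    have "cinner (?C (compression X \<xi>)) \<eta> = cinner (C (X \<xi>)) \<eta>"
      using \<xi> \<eta> compression_in[OF X \<xi>]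
      by (simp add: C_apply compression_apply wcomm_commute_E[OF C] cinner_E image_E_iff)
    also have "\<dots> = cinner (C (E \<xi>)) (dagger D X \<eta>)"
      using wcomm_cinner[OF C X] \<xi> \<eta> by (simp add: image_E_iff)
    also have "\<dots> = cinner (?C \<xi>) (dagger (E ` D) (compression X) \<eta>)"
      using \<xi> \<eta>
      by (simp add: C_apply dagger_compression[OF X] compression_apply wcomm_commute_E[OF C] cinner_E)
    finally show ?thesis .
  qed
  ultimately show ?thesis by (auto simp: wcomm_def ME_eq_compressions)
qed

definition inflation :: "('a \<Rightarrow> 'a) \<Rightarrow> 'a \<Rightarrow> 'a" where
  "inflation X = restr D (\<lambda>x. X (E x))"

lemma inflation_apply: "x \<in> D \<Longrightarrow> inflation X x = X (E x)"
  by (simp add: inflation_def restr_def)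

lemma ext_on_inflation: "ext_on D (inflation X)"
  by (simp add: ext_on_def inflation_def restr_def)

lemma cinner_inflation:
  assumes X: "X \<in> Ldag (E ` D)" and \<xi>: "\<xi> \<in> D" and \<eta>: "\<eta> \<in> D"
  shows "cinner (inflation X \<xi>) \<eta> = cinner \<xi> (inflation (dagger (E ` D) X) \<eta>)"
proof -
  have E\<xi>: "E \<xi> \<in> E ` D" and E\<eta>: "E \<eta> \<in> E ` D" using \<xi> \<eta> by auto
  have "cinner (inflation X \<xi>) \<eta> = cinner (X (E \<xi>)) (E \<eta>)"
    using \<xi> Ldag_in[OF X E\<xi>] by (simp add: inflation_apply cinner_E[symmetric] image_E_iff)
  also have "\<dots> = cinner (E \<xi>) (dagger (E ` D) X (E \<eta>))"
    by (rule cinner_dagger_right[OF csubspace_image_E X E\<xi> E\<eta>])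
  also have "\<dots> = cinner \<xi> (inflation (dagger (E ` D) X) \<eta>)"
    using \<eta> dagger_in[OF csubspace_image_E X E\<eta>] by (simp add: inflation_apply cinner_E image_E_iff)
  finally show ?thesis .
qed

lemma
  assumes X: "X \<in> Ldag (E ` D)"
  shows inflation_Ldag: "inflation X \<in> Ldag D"
    and dagger_inflation: "dagger D (inflation X) = inflation (dagger (E ` D) X)"
proof -
  have in_D: "inflation X \<xi> \<in> D" "inflation (dagger (E ` D) X) \<xi> \<in> D" if "\<xi> \<in> D" for \<xi>
    using that Ldag_in[OF X, of "E \<xi>"] dagger_in[OF csubspace_image_E X, of "E \<xi>"]
    by (simp_all add: inflation_apply image_E_iff E_in E_idem)
  show "inflation X \<in> Ldag D"
  proof (rule LdagI)
    show "clinear_on D (inflation X)"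
      using Ldag_linear[OF X] csubspace_add[OF csubspace_D] csubspace_scaleC[OF csubspace_D]
      by (simp add: clinear_on_def inflation_apply bop_add[OF bop_E] bop_scaleC[OF bop_E])
  qed (use in_D cinner_inflation[OF X] ext_on_inflation in auto)
  show "dagger D (inflation X) = inflation (dagger (E ` D) X)"
    by (rule dagger_eqI[OF csubspace_D])
      (use in_D cinner_inflation[OF X] ext_on_inflation in auto)
qed

lemma compression_inflation:
  assumes X: "X \<in> Ldag (E ` D)"
  shows "compression (inflation X) = X"
proof
  show "compression (inflation X) x = X x" for x
    using Ldag_in[OF X, of x] Ldag_outside[OF X, of x]
    by (cases "x \<in> E ` D")
      (simp_all add: compression_apply compression_outside inflation_apply image_E_iff)
qed

lemma inflation_in_M:
  assumes X: "X \<in> wbicomm_c (range E) (E ` D) (ME D E M)"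
  shows "inflation X \<in> M"
proof -
  have X_Ldag: "X \<in> Ldag (E ` D)" using X by (rule wbicomm_c_Ldag)
  have "cinner (C (inflation X \<xi>)) \<eta> = cinner (C \<xi>) (dagger D (inflation X) \<eta>)"
    if C: "C \<in> wcomm UNIV D M" and \<xi>: "\<xi> \<in> D" and \<eta>: "\<eta> \<in> D" for C \<xi> \<eta>
  proof -
    have E\<xi>: "E \<xi> \<in> E ` D" and E\<eta>: "E \<eta> \<in> E ` D" using \<xi> \<eta> by auto
    have C_apply: "restr (range E) C x = C x" if "x \<in> E ` D" for x using that by (auto simp: restr_def)
    have "cinner (C (inflation X \<xi>)) \<eta> = cinner (C (E (X (E \<xi>)))) \<eta>"
      using \<xi> Ldag_in[OF X_Ldag E\<xi>] by (simp add: inflation_apply image_E_iff)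
    also have "\<dots> = cinner (restr (range E) C (X (E \<xi>))) (E \<eta>)"
      using C_apply[OF Ldag_in[OF X_Ldag E\<xi>]] by (simp add: wcomm_commute_E[OF C] cinner_E)
    also have "\<dots> = cinner (restr (range E) C (E \<xi>)) (dagger (E ` D) X (E \<eta>))"
      by (rule wbicomm_c_cinner[OF X restr_in_wcomm_ME[OF C] E\<xi> E\<eta>])
    also have "\<dots> = cinner (C \<xi>) (E (dagger (E ` D) X (E \<eta>)))"
      using C_apply[OF E\<xi>] by (simp add: wcomm_commute_E[OF C] cinner_E)
    also have "\<dots> = cinner (C \<xi>) (dagger D (inflation X) \<eta>)"
      using \<eta> dagger_in[OF csubspace_image_E X_Ldag E\<eta>]
      by (simp add: dagger_inflation[OF X_Ldag] inflation_apply image_E_iff)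
    finally show ?thesis .
  qed
  then have "inflation X \<in> wbicomm_c UNIV D M"
    using inflation_Ldag[OF X_Ldag] by (simp add: wbicomm_c_def)
  then show ?thesis using M_eq_wbicomm_c by blast
qed

lemma ME_eq_wbicomm_c: "ME D E M = wbicomm_c (range E) (E ` D) (ME D E M)"
proof
  show "ME D E M \<subseteq> wbicomm_c (range E) (E ` D) (ME D E M)"
    using Ostar_ME by (auto simp: wbicomm_c_def Ostar_def wcomm_cinner)
  show "wbicomm_c (range E) (E ` D) (ME D E M) \<subseteq> ME D E M"
  proof
    fix X assume X: "X \<in> wbicomm_c (range E) (E ` D) (ME D E M)"
    then have "compression (inflation X) = X" by (intro compression_inflation wbicomm_c_Ldag)
    then show "X \<in> ME D E M" using inflation_in_M[OF X] by (metis ME_eq_compressions imageI)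
  qed
qed

subsection \<open>The weak commutant of the reduced algebra\<close>

lemma wcomm_ME_commute_bounded:
  assumes C: "C \<in> wcomm (range E) (E ` D) (ME D E M)"
    and B: "B \<in> bclos UNIV D ` Mb D M" and x: "x \<in> D"
  shows "C (E (B (E x))) = E (B (C (E x)))"
proof (rule range_E_eqI)
  have C_in: "C z \<in> range E" if "z \<in> range E" for z using bop_in[OF wcomm_bop[OF C] that] .
  then show "C (E (B (E x))) \<in> range E" "E (B (C (E x))) \<in> range E" by auto
  fix \<eta> assume \<eta>: "\<eta> \<in> E ` D"
  obtain X c where X: "X \<in> M" "B = bclos UNIV D X" "\<forall>\<xi>\<in>D. norm (X \<xi>) \<le> c * norm \<xi>"
    using B by (auto simp: Mb_def)
  have X_linear: "clinear_on D X" by (rule Ldag_linear[OF M_Ldag[OF X(1)]])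
  have bop_B: "bop UNIV B"
    unfolding X(2) by (rule bop_bclos[OF csubspace_D closure_D X_linear]) (use X(3) in blast)
  have B_eq: "B \<xi> = X \<xi>" if "\<xi> \<in> D" for \<xi>
    unfolding X(2) by (rule bclos_eq[OF csubspace_D closure_D X_linear _ that]) (use X(3) in blast)
  have adj_B: "adj B \<eta> = dagger D X \<eta>"
    by (rule adj_eq_dagger[OF csubspace_D closure_D M_Ldag[OF X(1)] bop_B B_eq])
      (use \<eta> in \<open>auto simp: image_E_iff\<close>)
  have Ex: "E x \<in> E ` D" using x by simp
  have "cinner (C (E (B (E x)))) \<eta> = cinner (C (compression X (E x))) \<eta>"
    using B_eq[OF E_in[OF x]] by (simp add: compression_apply[OF Ex])
  also have "\<dots> = cinner (C (E x)) (dagger (E ` D) (compression X) \<eta>)"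
    by (rule wcomm_cinner[OF C _ Ex \<eta>]) (simp add: X(1) ME_eq_compressions)
  also have "\<dots> = cinner (E (C (E x))) (adj B \<eta>)"
    using \<eta> by (simp add: dagger_compression[OF X(1)] compression_apply cinner_E adj_B)
  also have "\<dots> = cinner (E (B (C (E x)))) \<eta>"
    using \<eta> E_fixes[OF C_in[OF rangeI]]
    by (simp add: cinner_adj_right[OF bop_B, symmetric] cinner_E image_E_iff)
  finally show "cinner (C (E (B (E x)))) \<eta> = cinner (E (B (C (E x)))) \<eta>" .
qed

lemma wcomm_ME_in_reduced_commutant:
  assumes dense: "bcomm UNIV (wcomm UNIV D M) \<subseteq> sstar_closure UNIV (bclos UNIV D ` Mb D M)"
    and C: "C \<in> wcomm (range E) (E ` D) (ME D E M)"
  shows "(\<lambda>x. C (E x)) \<in> reduced_commutant (bcomm UNIV (wcomm UNIV D M)) E"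
proof -
  have bop_CE: "bop UNIV (\<lambda>x. C (E x))" by (rule bop_comp_projection[OF projection_E wcomm_bop[OF C]])
  have C_fixed: "E (C (E x)) = C (E x)" for x by (rule E_fixes[OF bop_in[OF wcomm_bop[OF C] rangeI]])
  have "C (E (A (E x))) = E (A (C (E x)))" if A: "A \<in> bcomm UNIV (wcomm UNIV D M)" for A x
  proof -
    have bop_A: "bop UNIV A" by (rule bcomm_bop[OF A])
    have "(\<lambda>x. C (E (A (E x)))) = (\<lambda>x. E (A (C (E x))))"
    proof (rule bop_eq_on_dense[OF _ _ closure_D])
      show "bop UNIV (\<lambda>x. C (E (A (E x))))"
        by (rule bop_UNIV_comp[OF bop_CE bop_UNIV_comp[OF bop_A bop_E]])
      show "bop UNIV (\<lambda>x. E (A (C (E x))))"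
        by (rule bop_UNIV_comp[OF bop_E bop_UNIV_comp[OF bop_A bop_CE]])
      show "C (E (A (E x))) = E (A (C (E x)))" if "x \<in> D" for x
        by (rule sstar_closure_eq[OF subsetD[OF dense A] bop_CE bop_E])
          (rule wcomm_ME_commute_bounded[OF C _ that])
    qed
    then show ?thesis by (rule fun_cong)
  qed
  then show ?thesis using bop_CE by (simp add: reduced_commutant_def bcomm_def E_idem C_fixed)
qed

lemma wcomm_ME_invariant:
  assumes dense: "bcomm UNIV (wcomm UNIV D M) \<subseteq> sstar_closure UNIV (bclos UNIV D ` Mb D M)"
    and C: "C \<in> wcomm (range E) (E ` D) (ME D E M)"
  shows "C ` (E ` D) \<subseteq> E ` D"
proof -
  interpret reduced_algebra "bcomm UNIV (wcomm UNIV D M)" E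
    by unfold_locales (simp_all add: star_closed_bcomm star_closed_wcomm bcomm_id bcomm_comp projection_E)
  obtain T where T: "T \<in> wcomm UNIV D M" "\<And>x. T (E x) = C (E x)"
    using reduced_commutant_extension[OF wcomm_ME_in_reduced_commutant[OF dense C]] wcomm_bicommutant
    by blast
  have "C (E x) = E (T x)" for x using T(2) wcomm_commute_E[OF T(1)] by metis
  then show ?thesis using wcomm_invariant[OF T(1)] by auto
qed

end

theorem theorem2p4:
  fixes M :: "('a::chilbert \<Rightarrow> 'a) set" and D :: "'a set" and E :: "'a \<Rightarrow> 'a"
  assumes "GWstar UNIV D M"
    and "sstar_closure UNIV (bclos UNIV D ` Mb D M) = bcomm UNIV (wcomm UNIV D M)"
    and "is_projection UNIV E"
    and "restr D E \<in> M"
  shows "GWstar (range E) (Dtilde (ME D E M) (E ` D)) (closure_alg (ME D E M) (E ` D))"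
proof -
  interpret reduced_GWstar D M E using assms by unfold_locales
  have "Dtilde (ME D E M) (E ` D) = E ` D" by (rule Dtilde_closed_O[OF closed_ME])
  moreover have "closure_alg (ME D E M) (E ` D) = ME D E M"
    by (rule closure_alg_closed_O[OF closed_ME]) (use Ostar_ME in \<open>simp add: Ostar_def\<close>)
  moreover have "C ` (E ` D) \<subseteq> E ` D" if "C \<in> wcomm (range E) (E ` D) (ME D E M)" for C
    using wcomm_ME_invariant[OF _ that] assms(2) by simp
  ultimately show ?thesis
    using Ostar_ME closed_ME ME_eq_wbicomm_c by (simp add: GWstar_def)
qed

end
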